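(* The following is a complete list of the (nonzero, proper) semisimple real Lie subalgebras of $\mathfrak{sl}_3(\mathbb{R})$ up to conjugation in $\mathrm{SL}_3(\mathbb{R})$: (1) $\mathfrak{u}_{3,16}=\langle X_{\alpha+\beta},\,Y_{\alpha+\beta},\,H_\alpha+H_\beta\rangle$; (2) $\mathfrak{u}_{3,17}=\langle X_\alpha+X_\beta,\,2Y_\alpha+2Y_\beta,\,2H_\alpha+2H_\beta\rangle$; (3) $\mathfrak{u}_{3,18}=\langle -X_{\alpha+\beta}+Y_{\alpha+\beta},\,2X_\alpha-\frac14Y_\alpha,\,-\frac14X_\beta+2Y_\beta\rangle$. That is, every nonzero proper semisimple real subalgebra of $\mathfrak{sl}_3(\mathbb{R})$ is conjugate under $\mathrm{SL}_3(\mathbb{R})$ to one of these three, and these three are pairwise non-conjugate under $\mathrm{SL}_3(\mathbb{R})$.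
   Context: $\mathfrak{sl}_3(\mathbb{R})$ is the Lie algebra of traceless real $3\times3$ matrices and $\mathrm{SL}_3(\mathbb{R})$ acts on its subalgebras by $g\cdot\mathfrak{u}=g\mathfrak{u}g^{-1}$; conjugate means lying in the same orbit of this action. With $E_{ij}$ the matrix units, the basis of $\mathfrak{sl}_3(\mathbb{R})$ used is $H_\alpha=E_{11}-E_{22}$, $H_\beta=E_{22}-E_{33}$, $X_\alpha=E_{12}$, $X_\beta=E_{23}$, $X_{\alpha+\beta}=-E_{13}$, $Y_\alpha=E_{21}$, $Y_\beta=E_{32}$, $Y_{\alpha+\beta}=-E_{31}$. $\langle\cdots\rangle$ denotes the real linear span. *)

theory Defs
  imports "HOL-Analysis.Analysis"
begin

definition lie_bracket :: "real^'n^'n \<Rightarrow> real^'n^'n \<Rightarrow> real^'n^'n" where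
  "lie_bracket A B = A ** B - B ** A"

definition lie_subalgebra :: "(real^'n^'n) set \<Rightarrow> bool" where
  "lie_subalgebra L \<longleftrightarrow> subspace L \<and> (\<forall>A\<in>L. \<forall>B\<in>L. lie_bracket A B \<in> L)"

definition lie_ideal :: "(real^'n^'n) set \<Rightarrow> (real^'n^'n) set \<Rightarrow> bool" where
  "lie_ideal I L \<longleftrightarrow> subspace I \<and> I \<subseteq> L \<and> (\<forall>A\<in>L. \<forall>B\<in>I. lie_bracket A B \<in> I)"

primrec derived_series :: "(real^'n^'n) set \<Rightarrow> nat \<Rightarrow> (real^'n^'n) set" where
  "derived_series L 0 = L"
| "derived_series L (Suc k) =
     span {lie_bracket A B | A B. A \<in> derived_series L k \<and> B \<in> derived_series L k}"

definition lie_solvable :: "(real^'n^'n) set \<Rightarrow> bool" where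
  "lie_solvable L \<longleftrightarrow> (\<exists>k. derived_series L k = {0})"

text \<open>Semisimple means that the radical (the largest solvable ideal) vanishes, that is, the only
  solvable ideal is zero. With this convention the zero algebra is semisimple.\<close>

definition lie_semisimple :: "(real^'n^'n) set \<Rightarrow> bool" where
  "lie_semisimple L \<longleftrightarrow> lie_subalgebra L \<and> (\<forall>I. lie_ideal I L \<and> lie_solvable I \<longrightarrow> I = {0})"

definition sl3 :: "(real^3^3) set" where
  "sl3 = {A. trace A = 0}"

definition SL3 :: "(real^3^3) set" where
  "SL3 = {g. det g = 1}"

definition conj_action :: "real^3^3 \<Rightarrow> (real^3^3) set \<Rightarrow> (real^3^3) set" where
  "conj_action g u = (\<lambda>A. g ** A ** matrix_inv g) ` u"

definition SL3_conjugate :: "(real^3^3) set \<Rightarrow> (real^3^3) set \<Rightarrow> bool" where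
  "SL3_conjugate u v \<longleftrightarrow> (\<exists>g\<in>SL3. v = conj_action g u)"

text \<open>The row and column indices are the elements 1, 2, 3 of the three-element type \<open>3\<close>
  (where 3 = 0).\<close>

definition mat_unit :: "3 \<Rightarrow> 3 \<Rightarrow> real^3^3" where
  "mat_unit i j = (\<chi> k l. if k = i \<and> l = j then 1 else 0)"

definition H_alpha :: "real^3^3" where "H_alpha = mat_unit 1 1 - mat_unit 2 2"
definition H_beta :: "real^3^3" where "H_beta = mat_unit 2 2 - mat_unit 3 3"
definition X_alpha :: "real^3^3" where "X_alpha = mat_unit 1 2"
definition X_beta :: "real^3^3" where "X_beta = mat_unit 2 3"
definition X_alpha_beta :: "real^3^3" where "X_alpha_beta = - mat_unit 1 3"
definition Y_alpha :: "real^3^3" where "Y_alpha = mat_unit 2 1"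
definition Y_beta :: "real^3^3" where "Y_beta = mat_unit 3 2"
definition Y_alpha_beta :: "real^3^3" where "Y_alpha_beta = - mat_unit 3 1"

definition u_3_16 :: "(real^3^3) set" where
  "u_3_16 = span {X_alpha_beta, Y_alpha_beta, H_alpha + H_beta}"

definition u_3_17 :: "(real^3^3) set" where
  "u_3_17 = span {X_alpha + X_beta,
                  2 *\<^sub>R Y_alpha + 2 *\<^sub>R Y_beta,
                  2 *\<^sub>R H_alpha + 2 *\<^sub>R H_beta}"

definition u_3_18 :: "(real^3^3) set" where
  "u_3_18 = span {- X_alpha_beta + Y_alpha_beta,
                  2 *\<^sub>R X_alpha - (1/4) *\<^sub>R Y_alpha,
                  - ((1/4) *\<^sub>R X_beta) + 2 *\<^sub>R Y_beta}"

end

(* Split by whether the subalgebra L acts irreducibly on R^3.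

   If L fixes a line (or a plane, which becomes a line under A |-> -A^T), the elements with vanishing
   diagonal block and those with scalar block form abelian ideals, hence vanish; dimensions up to two
   are solvable, so the block runs through all of sl2, and diagonalising the lift of diag(1,-1) splits
   off the line.

   If L is irreducible, nilpotent elements decide. A square-zero X != 0 can be taken to be E13; then
   L contains a conjugate of diag(1,0,-1), and the grading it induces forces L = sl3. If L contains a
   nilpotent N with N^2 != 0 but no square-zero element, take N = E12 + E23; the same grading leaves
   only the principal sl2. If L has no nilpotents, ad A has no nonzero real eigenvalue on L, since the
   eigenvectors would be nilpotent. Hence every nonzero A in L has eigenvalues 0 and +-bi, and
   decomposing L under the rotation generator E21 - E12 exhibits it as a conjugate of so(3). *)

theory Submission
  imports Defs
begin

section \<open>Matrices of size three by entries\<close>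

text \<open>No complexification is used. Where eigenspaces of \<open>ad A\<close> would be split off
  over the complex numbers, a real polynomial in \<open>ad A\<close> is applied instead; L is closed
  under it, so the surviving components are again matrices of L. The rational coefficients in such
  combinations come from interpolation at the known eigenvalues. Nilpotency is measured by tr(X^2)
  and det X: for traceless X the characteristic polynomial is t^3 - (tr(X^2)/2) t - det X. Both are
  conjugation invariants, so the case distinction survives every change of basis. The delicate point
  without nilpotents is that the real eigenvalue l of an element A must vanish. Once A is block
  diagonal with blocks B and l, \<open>ad A\<close> acts on the off-diagonal column as B - l and on
  the off-diagonal row with the opposite eigenvalues. These are non-real, with real parts -3l/2 and
  3l/2. For l nonzero the two spectra are disjoint, a polynomial separates column from row, and what
  remains of the row is nilpotent, hence zero.\<close>

definition mat3 :: "real \<Rightarrow> real \<Rightarrow> real \<Rightarrow> real \<Rightarrow> real \<Rightarrow> real \<Rightarrow> real \<Rightarrow> real \<Rightarrow> real \<Rightarrow> real^3^3" where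
  "mat3 a b c d e f g h i = vector [vector [a, b, c], vector [d, e, f], vector [g, h, i]]"

lemma mat3_nth [simp]:
  "mat3 a b c d e f g h i $ 1 $ 1 = a" "mat3 a b c d e f g h i $ 1 $ 2 = b"
  "mat3 a b c d e f g h i $ 1 $ 3 = c" "mat3 a b c d e f g h i $ 2 $ 1 = d"
  "mat3 a b c d e f g h i $ 2 $ 2 = e" "mat3 a b c d e f g h i $ 2 $ 3 = f"
  "mat3 a b c d e f g h i $ 3 $ 1 = g" "mat3 a b c d e f g h i $ 3 $ 2 = h"
  "mat3 a b c d e f g h i $ 3 $ 3 = i"
  by (simp_all add: mat3_def)

lemma mat3_eta:
  "mat3 (A$1$1) (A$1$2) (A$1$3) (A$2$1) (A$2$2) (A$2$3) (A$3$1) (A$3$2) (A$3$3) = A"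
  by (simp add: vec_eq_iff forall_3)

lemma mat3_cases [cases type]:
  obtains a b c d e f g h i where "A = mat3 a b c d e f g h i"
  using mat3_eta[of A] by metis

lemma mat3_eq_iff [simp]:
  "mat3 a b c d e f g h i = mat3 a' b' c' d' e' f' g' h' i' \<longleftrightarrow>
    a = a' \<and> b = b' \<and> c = c' \<and> d = d' \<and> e = e' \<and> f = f' \<and> g = g' \<and> h = h' \<and> i = i'"
  by (auto simp: vec_eq_iff forall_3)

lemma mat3_zero: "0 = mat3 0 0 0 0 0 0 0 0 0"
  by (simp add: vec_eq_iff forall_3)

lemma mat3_eq_0_iff [simp]:
  "mat3 a b c d e f g h i = 0 \<longleftrightarrow>
    a = 0 \<and> b = 0 \<and> c = 0 \<and> d = 0 \<and> e = 0 \<and> f = 0 \<and> g = 0 \<and> h = 0 \<and> i = 0"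
  by (simp add: mat3_zero)

lemma mat3_one: "mat 1 = mat3 1 0 0 0 1 0 0 0 1"
  by (simp add: vec_eq_iff forall_3 mat_def)

lemma mat3_arith [simp]:
  "mat3 a b c d e f g h i + mat3 a' b' c' d' e' f' g' h' i' =
    mat3 (a + a') (b + b') (c + c') (d + d') (e + e') (f + f') (g + g') (h + h') (i + i')"
  "mat3 a b c d e f g h i - mat3 a' b' c' d' e' f' g' h' i' =
    mat3 (a - a') (b - b') (c - c') (d - d') (e - e') (f - f') (g - g') (h - h') (i - i')"
  "- mat3 a b c d e f g h i = mat3 (- a) (- b) (- c) (- d) (- e) (- f) (- g) (- h) (- i)"
  "r *\<^sub>R mat3 a b c d e f g h i =
    mat3 (r * a) (r * b) (r * c) (r * d) (r * e) (r * f) (r * g) (r * h) (r * i)"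
  "transpose (mat3 a b c d e f g h i) = mat3 a d g b e h c f i"
  by (simp_all add: vec_eq_iff forall_3 transpose_def)

lemma mat3_mult [simp]:
  "mat3 a b c d e f g h i ** mat3 a' b' c' d' e' f' g' h' i' =
    mat3 (a * a' + b * d' + c * g') (a * b' + b * e' + c * h') (a * c' + b * f' + c * i')
         (d * a' + e * d' + f * g') (d * b' + e * e' + f * h') (d * c' + e * f' + f * i')
         (g * a' + h * d' + i * g') (g * b' + h * e' + i * h') (g * c' + h * f' + i * i')"
  by (simp add: vec_eq_iff forall_3 matrix_matrix_mult_def sum_3)

lemma mat3_mult_vec [simp]:
  "(mat3 a b c d e f g h i *v v) = vector [a * v$1 + b * v$2 + c * v$3,
     d * v$1 + e * v$2 + f * v$3, g * v$1 + h * v$2 + i * v$3]"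
  by (simp add: vec_eq_iff forall_3 matrix_vector_mult_def sum_3)

lemma mat3_trace [simp]: "trace (mat3 a b c d e f g h i) = a + e + i"
  by (simp add: trace_def sum_3)

lemma mat3_det [simp]:
  "det (mat3 a b c d e f g h i) = a * e * i + b * f * g + c * d * h - a * f * h - b * d * i - c * e * g"
  by (simp add: det_3)

lemma mat_unit_mat3:
  "mat_unit 1 1 = mat3 1 0 0 0 0 0 0 0 0" "mat_unit 1 2 = mat3 0 1 0 0 0 0 0 0 0"
  "mat_unit 1 3 = mat3 0 0 1 0 0 0 0 0 0" "mat_unit 2 1 = mat3 0 0 0 1 0 0 0 0 0"
  "mat_unit 2 2 = mat3 0 0 0 0 1 0 0 0 0" "mat_unit 2 3 = mat3 0 0 0 0 0 1 0 0 0"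
  "mat_unit 3 1 = mat3 0 0 0 0 0 0 1 0 0" "mat_unit 3 2 = mat3 0 0 0 0 0 0 0 1 0"
  "mat_unit 3 3 = mat3 0 0 0 0 0 0 0 0 1"
  by (simp_all add: vec_eq_iff forall_3 mat_unit_def)

lemma span_3:
  fixes a b c :: "'a::real_vector"
  shows "span {a, b, c} = {x *\<^sub>R a + y *\<^sub>R b + z *\<^sub>R c | x y z. True}"
proof -
  have "v \<in> span {a, b, c} \<longleftrightarrow> (\<exists>x y z. v = x *\<^sub>R a + y *\<^sub>R b + z *\<^sub>R c)" for v
  proof -
    have "v \<in> span {a, b, c} \<longleftrightarrow> (\<exists>x y z. v - x *\<^sub>R a - y *\<^sub>R b = z *\<^sub>R c)"
      by (auto simp: span_breakdown_eq span_singleton)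
    then show ?thesis
      by (simp add: algebra_simps)
  qed
  then show ?thesis by blast
qed

lemmas sl3_basis_defs = H_alpha_def H_beta_def X_alpha_def X_beta_def X_alpha_beta_def
  Y_alpha_def Y_beta_def Y_alpha_beta_def

lemma u_3_16_eq: "u_3_16 = {mat3 c 0 a 0 0 0 b 0 (- c) | a b c. True}"
proof -
  have "u_3_16 = {mat3 z 0 (- x) 0 0 0 (- y) 0 (- z) | x y z. True}"
    by (simp add: u_3_16_def span_3 sl3_basis_defs mat_unit_mat3)
  also have "\<dots> = {mat3 c 0 a 0 0 0 b 0 (- c) | a b c. True}"
    by auto (metis minus_minus)+
  finally show ?thesis .
qed

text \<open>In this form the matrices are recognisable as the Lie algebra of the indefinite form 2xz
  - y^2, a copy of so(2,1).\<close>

lemma u_3_17_eq: "u_3_17 = {mat3 c a 0 b 0 a 0 b (- c) | a b c. True}"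
proof -
  have "u_3_17 = {mat3 (2*z) x 0 (2*y) 0 x 0 (2*y) (- 2*z) | x y z. True}"
    by (simp add: u_3_17_def span_3 sl3_basis_defs mat_unit_mat3 mult_ac)
  also have "\<dots> = {mat3 c a 0 b 0 a 0 b (- c) | a b c. True}"
    apply auto
    apply (rule_tac x="b/2" in exI, rule_tac x="c/2" in exI, simp)
    done
  finally show ?thesis .
qed

text \<open>These are the matrices that are skew for the definite form x^2 + 8 y^2 + z^2, a copy of
  so(3); the 8 is the ratio of the coefficients 2 and 1/4 in the generators.\<close>

lemma u_3_18_eq: "u_3_18 = {mat3 0 (8*a) b (- a) 0 (- c) (- b) (8*c) 0 | a b c. True}"
proof -
  have "u_3_18 = {mat3 0 (2*y) x (- y/4) 0 (- z/4) (- x) (2*z) 0 | x y z. True}"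
    by (simp add: u_3_18_def span_3 sl3_basis_defs mat_unit_mat3 mult_ac)
  also have "\<dots> = {mat3 0 (8*a) b (- a) 0 (- c) (- b) (8*c) 0 | a b c. True}"
    apply auto
    apply (rule_tac x="y/4" in exI, simp, rule_tac x="z/4" in exI, simp)
    done
  finally show ?thesis .
qed

section \<open>Conjugation\<close>

lemma lie_bracket_mat3 [simp]:
  "lie_bracket (mat3 a b c d e f g h i) (mat3 a' b' c' d' e' f' g' h' i') =
    mat3 a b c d e f g h i ** mat3 a' b' c' d' e' f' g' h' i' -
    mat3 a' b' c' d' e' f' g' h' i' ** mat3 a b c d e f g h i"
  by (simp add: lie_bracket_def)

lemma mat3_mem_sl3 [simp]: "mat3 a b c d e f g h i \<in> sl3 \<longleftrightarrow> a + e + i = 0"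
  by (simp add: sl3_def)

lemma matrix_scaleR_left: "(r *\<^sub>R A) ** B = r *\<^sub>R (A ** B)" for A :: "real^'n^'m"
  by (simp add: vec_eq_iff matrix_matrix_mult_def sum_distrib_left mult_ac)

lemma matrix_scaleR_right: "A ** (r *\<^sub>R B) = r *\<^sub>R (A ** B)" for A :: "real^'n^'m"
  by (simp add: vec_eq_iff matrix_matrix_mult_def sum_distrib_left mult_ac)

lemma matrix_add_left: "(A + B) ** C = A ** C + B ** C" for A :: "real^'n^'m"
  by (simp add: vec_eq_iff matrix_matrix_mult_def sum.distrib distrib_right)

lemma matrix_diff_left: "(A - B) ** C = A ** C - B ** C" for A :: "real^'n^'m"
  by (simp add: vec_eq_iff matrix_matrix_mult_def sum_subtractf left_diff_distrib)

lemma matrix_diff_right: "C ** (A - B) = C ** A - C ** B" for A :: "real^'n^'m"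
  by (simp add: vec_eq_iff matrix_matrix_mult_def sum_subtractf right_diff_distrib)

lemma transpose_diff: "transpose (A - B) = transpose A - transpose B" for A :: "real^'n^'m"
  by (simp add: vec_eq_iff transpose_def)

lemma lie_bracket_linear_simps:
  "lie_bracket (A + B) C = lie_bracket A C + lie_bracket B C"
  "lie_bracket A (B + C) = lie_bracket A B + lie_bracket A C"
  "lie_bracket (r *\<^sub>R A) B = r *\<^sub>R lie_bracket A B"
  "lie_bracket A (r *\<^sub>R B) = r *\<^sub>R lie_bracket A B"
  by (simp_all add: lie_bracket_def matrix_add_ldistrib matrix_add_left matrix_scaleR_left
      matrix_scaleR_right algebra_simps)

lemma lie_bracket_self: "lie_bracket A A = 0"
  by (simp add: lie_bracket_def)

lemma lie_bracket_swap: "lie_bracket B A = - lie_bracket A B"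
  by (simp add: lie_bracket_def)

text \<open>The inverse is a separate argument, so that \<open>h ** g = mat 1\<close> enters as a
  plain equation and transposition only swaps and transposes the two arguments.\<close>

definition conjm :: "real^'n^'n \<Rightarrow> real^'n^'n \<Rightarrow> real^'n^'n \<Rightarrow> real^'n^'n" where
  "conjm g h A = g ** A ** h"

lemma linear_conjm: "linear (conjm g h)"
  by (rule linearI)
     (simp_all add: conjm_def matrix_add_ldistrib matrix_add_left matrix_scaleR_left matrix_scaleR_right)

lemma conjm_inverse:
  assumes "h ** g = mat 1"
  shows "conjm h g (conjm g h A) = A"
proof -
  have "conjm h g (conjm g h A) = (h ** g) ** A ** (h ** g)"
    by (simp add: conjm_def matrix_mul_assoc)
  then show ?thesis by (simp add: assms)
qed

lemma conjm_mult:
  assumes "h ** g = mat 1"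
  shows "conjm g h (A ** B) = conjm g h A ** conjm g h B"
proof -
  have "conjm g h A ** conjm g h B = g ** A ** (h ** g) ** B ** h"
    by (simp add: conjm_def matrix_mul_assoc)
  then show ?thesis by (simp add: assms conjm_def matrix_mul_assoc)
qed

lemma conjm_lie_bracket:
  assumes "h ** g = mat 1"
  shows "conjm g h (lie_bracket A B) = lie_bracket (conjm g h A) (conjm g h B)"
  by (simp add: lie_bracket_def linear_diff[OF linear_conjm] conjm_mult[OF assms])

lemma trace_conjm:
  assumes "h ** g = mat 1"
  shows "trace (conjm g h A) = trace A"
proof -
  have "trace (conjm g h A) = trace (h ** (g ** A))"
    unfolding conjm_def by (rule trace_mul_sym)
  then show ?thesis by (simp add: matrix_mul_assoc assms)
qed

lemma det_conjm:
  assumes "h ** g = mat 1"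
  shows "det (conjm g h A) = det A"
proof -
  have "det h * det g = 1" by (metis assms det_mul det_I)
  then show ?thesis by (simp add: conjm_def det_mul mult_ac)
qed

lemma matrix_inv_unique:
  assumes "g ** h = mat 1" "h ** g = mat 1"
  shows "matrix_inv g = h"
proof -
  have "g ** matrix_inv g = mat 1 \<and> matrix_inv g ** g = mat 1"
    unfolding matrix_inv_def by (rule someI[where x = h]) (use assms in simp)
  then show ?thesis by (metis assms(2) matrix_mul_assoc matrix_mul_lid matrix_mul_rid)
qed

text \<open>Scaling g does not change conjugation by it, and in odd dimension the real cube root of
  det g, of either sign, scales the determinant to 1. Hence any invertible matrix may be used from
  here on.\<close>

lemma SL3_conjugate_iff:
  "SL3_conjugate u v \<longleftrightarrow> (\<exists>g h. g ** h = mat 1 \<and> h ** g = mat 1 \<and> v = conjm g h ` u)"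
proof
  assume "SL3_conjugate u v"
  then obtain g where g: "det g = 1" and v: "v = conj_action g u"
    by (auto simp: SL3_conjugate_def SL3_def)
  then have "invertible g" by (simp add: invertible_det_nz)
  then obtain h where h: "g ** h = mat 1" "h ** g = mat 1" by (auto simp: invertible_def)
  then show "\<exists>g h. g ** h = mat 1 \<and> h ** g = mat 1 \<and> v = conjm g h ` u"
    using v by (auto simp: conj_action_def conjm_def matrix_inv_unique)
next
  assume "\<exists>g h. g ** h = mat 1 \<and> h ** g = mat 1 \<and> v = conjm g h ` u"
  then obtain g h where gh: "g ** h = mat 1" "h ** g = mat 1" and v: "v = conjm g h ` u" by blast
  have dg: "det g \<noteq> 0" using gh by (metis det_mul det_I mult_zero_left zero_neq_one)
  define c where "c = inverse (root 3 (det g))"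
  have c0: "c \<noteq> 0" using dg by (simp add: c_def)
  have c3: "c ^ 3 * det g = 1"
    using dg by (simp add: c_def power_inverse odd_real_root_pow)
  have "det (c *\<^sub>R g) = c ^ 3 * det g"
    by (cases g rule: mat3_cases) (simp add: algebra_simps power3_eq_cube)
  then have "c *\<^sub>R g \<in> SL3" using c3 by (simp add: SL3_def)
  moreover have "matrix_inv (c *\<^sub>R g) = inverse c *\<^sub>R h"
    using c0 gh by (intro matrix_inv_unique) (simp_all add: matrix_scaleR_left matrix_scaleR_right)
  then have "conj_action (c *\<^sub>R g) u = v"
    using c0 by (simp add: conj_action_def v conjm_def matrix_scaleR_left matrix_scaleR_right)
  ultimately show "SL3_conjugate u v" unfolding SL3_conjugate_def by blast
qed

lemma SL3_conjugate_sym: "SL3_conjugate u v \<Longrightarrow> SL3_conjugate v u"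
  unfolding SL3_conjugate_iff by (metis (no_types, lifting) conjm_inverse image_image image_cong image_ident)

lemma SL3_conjugate_trans:
  assumes "SL3_conjugate u v" "SL3_conjugate v w"
  shows "SL3_conjugate u w"
proof -
  obtain g h where gh: "g ** h = mat 1" "h ** g = mat 1" "v = conjm g h ` u"
    using assms(1) by (auto simp: SL3_conjugate_iff)
  obtain g' h' where gh': "g' ** h' = mat 1" "h' ** g' = mat 1" "w = conjm g' h' ` v"
    using assms(2) by (auto simp: SL3_conjugate_iff)
  have "(g' ** g) ** (h ** h') = g' ** (g ** h) ** h'" "(h ** h') ** (g' ** g) = h ** (h' ** g') ** g"
    by (simp_all add: matrix_mul_assoc)
  then have "(g' ** g) ** (h ** h') = mat 1" "(h ** h') ** (g' ** g) = mat 1"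
    by (simp_all add: gh gh')
  moreover have "w = conjm (g' ** g) (h ** h') ` u"
    by (simp add: gh gh' image_image conjm_def matrix_mul_assoc)
  ultimately show ?thesis unfolding SL3_conjugate_iff by blast
qed

text \<open>\<open>X ** P = P ** X'\<close> says that X' is the matrix of X in the basis formed by
  the columns of P. In this form membership in the conjugate algebra is checked by multiplying
  entries, without computing an inverse.\<close>

lemma change_basis:
  fixes P :: "real^3^3"
  assumes "det P \<noteq> 0"
  obtains L' where "SL3_conjugate L L'" "\<And>X X'. X \<in> L \<Longrightarrow> X ** P = P ** X' \<Longrightarrow> X' \<in> L'"
    "\<And>X'. X' \<in> L' \<Longrightarrow> \<exists>X\<in>L. X ** P = P ** X'"
proof -
  have "invertible P" using assms by (simp add: invertible_det_nz)
  then obtain g where g: "P ** g = mat 1" "g ** P = mat 1" by (auto simp: invertible_def)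
  show thesis
  proof
    show "SL3_conjugate L (conjm g P ` L)" unfolding SL3_conjugate_iff using g by blast
    show "X' \<in> conjm g P ` L" if "X \<in> L" "X ** P = P ** X'" for X X'
    proof -
      have "conjm g P X = (g ** P) ** X'"
        unfolding conjm_def using that by (metis matrix_mul_assoc)
      then show ?thesis using that g by (metis image_eqI matrix_mul_lid)
    qed
    show "\<exists>X\<in>L. X ** P = P ** X'" if "X' \<in> conjm g P ` L" for X'
    proof -
      obtain X where "X \<in> L" "X' = conjm g P X" using \<open>X' \<in> conjm g P ` L\<close> by blast
      moreover have "P ** conjm g P X = (P ** g) ** X ** P" by (simp add: conjm_def matrix_mul_assoc)
      ultimately show ?thesis using g by auto
    qed
  qed
qed

section \<open>Absence of invariant lines and planes, and its invariance under conjugation\<close>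

definition irreducible_on :: "(real^'n^'n) set \<Rightarrow> bool" where
  "irreducible_on L \<longleftrightarrow> (\<forall>v. v \<noteq> 0 \<longrightarrow> (\<exists>A\<in>L. \<forall>c. A *v v \<noteq> c *\<^sub>R v))"

text \<open>In dimension three a proper nonzero invariant subspace is a line or a plane, and the planes are
  the lines invariant under the transposed matrices.\<close>

definition irreducible_sl3_subalgebra :: "(real^3^3) set \<Rightarrow> bool" where
  "irreducible_sl3_subalgebra L \<longleftrightarrow> lie_subalgebra L \<and> L \<subseteq> sl3 \<and> irreducible_on L \<and>
    irreducible_on (transpose ` L)"

lemma irreducible_on_conjm:
  fixes L :: "(real^'n^'n) set"
  assumes "irreducible_on L" "g ** h = mat 1" "h ** g = mat 1"
  shows "irreducible_on (conjm g h ` L)"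
  unfolding irreducible_on_def
proof (intro allI impI)
  fix v :: "real^'n" assume "v \<noteq> 0"
  have vgh: "g *v (h *v v) = v" by (simp add: matrix_vector_mul_assoc assms)
  have "h *v v \<noteq> 0" using vgh \<open>v \<noteq> 0\<close> by auto
  then obtain A where A: "A \<in> L" "\<And>c. A *v (h *v v) \<noteq> c *\<^sub>R (h *v v)"
    using assms(1) unfolding irreducible_on_def by blast
  have "conjm g h A *v v \<noteq> c *\<^sub>R v" for c
  proof
    assume "conjm g h A *v v = c *\<^sub>R v"
    then have "h *v (conjm g h A *v v) = c *\<^sub>R (h *v v)" by (simp add: matrix_vector_mult_scaleR)
    moreover have "h *v (conjm g h A *v v) = (h ** g) *v (A *v (h *v v))"
      by (simp add: conjm_def matrix_vector_mul_assoc matrix_mul_assoc)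
    ultimately show False using A(2) assms(3) by simp
  qed
  then show "\<exists>A\<in>conjm g h ` L. \<forall>c. A *v v \<noteq> c *\<^sub>R v" using A(1) by blast
qed

lemma transpose_conjm: "transpose (conjm g h A) = conjm (transpose h) (transpose g) (transpose A)"
  by (simp add: conjm_def matrix_transpose_mul matrix_mul_assoc)

lemma lie_subalgebra_image:
  assumes "lie_subalgebra L" "linear f" "\<And>A B. f (lie_bracket A B) = lie_bracket (f A) (f B)"
  shows "lie_subalgebra (f ` L)"
  using assms unfolding lie_subalgebra_def by (auto simp: linear_subspace_image) (metis imageI)

lemma irreducible_sl3_subalgebra_conj:
  assumes "irreducible_sl3_subalgebra L" "SL3_conjugate L L'"
  shows "irreducible_sl3_subalgebra L'"
proof -
  obtain g h where gh: "g ** h = mat 1" "h ** g = mat 1" and L': "L' = conjm g h ` L"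
    using assms(2) by (auto simp: SL3_conjugate_iff)
  have "transpose ` L' = conjm (transpose h) (transpose g) ` transpose ` L"
    by (simp add: L' image_image transpose_conjm)
  moreover have "transpose h ** transpose g = mat 1" "transpose g ** transpose h = mat 1"
    using gh by (simp_all flip: matrix_transpose_mul)
  ultimately show ?thesis
    using assms(1) gh
    by (auto simp: irreducible_sl3_subalgebra_def L' irreducible_on_conjm lie_subalgebra_image
        linear_conjm conjm_lie_bracket sl3_def trace_conjm)
qed

text \<open>Conjugation preserves the trace, so \<open>sl3\<close> is alone in its orbit. This
  carries the conclusion \<open>L = sl3\<close> back from a normalised conjugate.\<close>

lemma SL3_conjugate_sl3:
  assumes "SL3_conjugate L sl3"
  shows "L = sl3"
proof -
  obtain g h where gh: "g ** h = mat 1" "h ** g = mat 1" and L': "L = conjm g h ` sl3"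
    using SL3_conjugate_sym[OF assms] by (auto simp: SL3_conjugate_iff)
  have "A \<in> L" if "A \<in> sl3" for A
  proof -
    have "A = conjm g h (conjm h g A)" using gh by (simp add: conjm_inverse)
    moreover have "conjm h g A \<in> sl3" using that gh by (simp add: sl3_def trace_conjm)
    ultimately show ?thesis unfolding L' by blast
  qed
  then show ?thesis unfolding L' using gh by (auto simp: sl3_def trace_conjm)
qed

section \<open>Irreducible subalgebras with nilpotent elements\<close>

lemma lie_subalgebraD:
  assumes "lie_subalgebra L"
  shows "A \<in> L \<Longrightarrow> B \<in> L \<Longrightarrow> A + B \<in> L" "A \<in> L \<Longrightarrow> B \<in> L \<Longrightarrow> A - B \<in> L"
    "A \<in> L \<Longrightarrow> r *\<^sub>R A \<in> L" "A \<in> L \<Longrightarrow> B \<in> L \<Longrightarrow> lie_bracket A B \<in> L"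
  using assms unfolding lie_subalgebra_def
  by (blast intro: subspace_add subspace_diff subspace_scale)+

lemma irreducible_sl3_subalgebraD:
  assumes "irreducible_sl3_subalgebra L"
  shows "lie_subalgebra L" "A \<in> L \<Longrightarrow> trace A = 0"
  using assms by (auto simp: irreducible_sl3_subalgebra_def sl3_def)

text \<open>Otherwise the j-th standard basis vector would be a common eigenvector.\<close>

lemma irreducible_on_column:
  fixes L :: "(real^'n^'n) set"
  assumes "irreducible_on L"
  shows "\<exists>A\<in>L. \<exists>i. i \<noteq> j \<and> A $ i $ j \<noteq> 0"
proof (rule ccontr)
  assume "\<not> ?thesis"
  then have 0: "A $ i $ j = 0" if "A \<in> L" "i \<noteq> j" for A i using that by blast
  have "axis j (1::real) \<noteq> (0 :: real^'n)" by (simp add: axis_eq_0_iff)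
  then obtain A where A: "A \<in> L" "\<And>c. A *v axis j 1 \<noteq> c *\<^sub>R axis j 1"
    using assms unfolding irreducible_on_def by blast
  have "column j A = A $ j $ j *\<^sub>R axis j 1"
    using 0[OF A(1)] by (auto simp: vec_eq_iff column_def axis_def)
  then have "A *v axis j 1 = A $ j $ j *\<^sub>R axis j 1"
    by (simp add: matrix_vector_mult_basis)
  then show False using A(2) by blast
qed

lemma irreducible_column:
  assumes "irreducible_sl3_subalgebra L"
  shows "\<exists>A\<in>L. \<exists>i. i \<noteq> j \<and> A $ i $ j \<noteq> 0"
  using assms irreducible_on_column unfolding irreducible_sl3_subalgebra_def by blast

lemma irreducible_row:
  assumes "irreducible_sl3_subalgebra L"
  shows "\<exists>A\<in>L. \<exists>j. j \<noteq> i \<and> A $ i $ j \<noteq> 0"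
  using assms irreducible_on_column[of "transpose ` L" i]
  unfolding irreducible_sl3_subalgebra_def by (auto simp: transpose_def)

section \<open>Matrices given by their columns, and the grading of sl3\<close>

definition cols :: "real^3 \<Rightarrow> real^3 \<Rightarrow> real^3 \<Rightarrow> real^3^3" where
  "cols a b c = mat3 (a$1) (b$1) (c$1) (a$2) (b$2) (c$2) (a$3) (b$3) (c$3)"

lemma cols_mult_vec: "cols a b c *v v = v$1 *\<^sub>R a + v$2 *\<^sub>R b + v$3 *\<^sub>R c"
  by (simp add: cols_def vec_eq_iff forall_3)

lemma mult_cols: "A ** cols a b c = cols (A *v a) (A *v b) (A *v c)"
  by (cases A rule: mat3_cases) (simp add: cols_def)

lemma cols_mult_mat3: "cols u v w ** mat3 a b c d e f g h i =
    cols (a *\<^sub>R u + d *\<^sub>R v + g *\<^sub>R w) (b *\<^sub>R u + e *\<^sub>R v + h *\<^sub>R w) (c *\<^sub>R u + f *\<^sub>R v + i *\<^sub>R w)"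
  by (simp add: cols_def mult_ac)

lemma det_cols_nonzero:
  assumes "\<And>x y z. x *\<^sub>R a + y *\<^sub>R b + z *\<^sub>R c = 0 \<Longrightarrow> x = 0 \<and> y = 0 \<and> z = 0"
  shows "det (cols a b c) \<noteq> 0"
proof -
  have "v = 0" if "cols a b c *v v = 0" for v
    using assms[of "v$1" "v$2" "v$3"] that by (simp add: cols_mult_vec vec_eq_iff forall_3)
  then have "\<exists>B. B ** cols a b c = mat 1"
    using matrix_left_invertible_ker by blast
  then show ?thesis by (simp flip: invertible_det_nz add: invertible_left_inverse)
qed

text \<open>For H = diag(1,0,-1) the map \<open>ad H\<close> is diagonalisable with eigenvalues 2,
  1, 0, -1, -2. The five matrices are the eigencomponents of X, each a polynomial in
  \<open>ad H\<close> applied to X.\<close>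

lemma mat3_gradation:
  assumes L: "lie_subalgebra L" and H: "mat3 1 0 0 0 0 0 0 0 (-1) \<in> L"
    and X: "X \<in> L"
  shows "mat3 0 0 (X$1$3) 0 0 0 0 0 0 \<in> L" "mat3 0 (X$1$2) 0 0 0 (X$2$3) 0 0 0 \<in> L"
    "mat3 (X$1$1) 0 0 0 (X$2$2) 0 0 0 (X$3$3) \<in> L" "mat3 0 0 0 (X$2$1) 0 0 0 (X$3$2) 0 \<in> L"
    "mat3 0 0 0 0 0 0 (X$3$1) 0 0 \<in> L"
proof -
  obtain a b c d e f g h i where X_eq: "X = mat3 a b c d e f g h i" by (rule mat3_cases)
  let ?T = "lie_bracket (mat3 1 0 0 0 0 0 0 0 (-1))"
  define X0 where "X0 = X"
  define X1 where "X1 = ?T X0"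
  define X2 where "X2 = ?T X1"
  define X3 where "X3 = ?T X2"
  define X4 where "X4 = ?T X3"
  note T = lie_subalgebraD(4)[OF L H]
  note mem = X T[OF X] T[OF T[OF X]] T[OF T[OF T[OF X]]] T[OF T[OF T[OF T[OF X]]]]
  note mem = mem[folded X0_def, folded X1_def, folded X2_def, folded X3_def, folded X4_def]
  note defs = X4_def X3_def X2_def X1_def X0_def X_eq
  note cl = lie_subalgebraD(1,2,3)[OF L]
  \<comment> \<open>Interpolation: (t^4 - t^2)/24 equals 1/2 at t = 2 and t = -2, (t^3 - t)/12
    equals 1/2 and -1/2 there, and both vanish at 0, 1, -1.\<close>
  have "(1/24) *\<^sub>R (X4 - X2) + (1/12) *\<^sub>R (X3 - X1) \<in> L" by (intro cl mem)
  then have 2: "mat3 0 0 c 0 0 0 0 0 0 \<in> L" by (simp add: defs)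
  have "(1/24) *\<^sub>R (X4 - X2) - (1/12) *\<^sub>R (X3 - X1) \<in> L" by (intro cl mem)
  then have m2: "mat3 0 0 0 0 0 0 g 0 0 \<in> L" by (simp add: defs)
  \<comment> \<open>Likewise (4t^2 - t^4)/6 equals 1/2 at t = 1 and t = -1, (4t - t^3)/6 equals 1/2
    and -1/2 there, and both vanish at 0, 2, -2.\<close>
  have "(1/6) *\<^sub>R (4 *\<^sub>R X2 - X4) + (1/6) *\<^sub>R (4 *\<^sub>R X1 - X3) \<in> L" by (intro cl mem)
  then have 1: "mat3 0 b 0 0 0 f 0 0 0 \<in> L" by (simp add: defs)
  have "(1/6) *\<^sub>R (4 *\<^sub>R X2 - X4) - (1/6) *\<^sub>R (4 *\<^sub>R X1 - X3) \<in> L" by (intro cl mem)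
  then have m1: "mat3 0 0 0 d 0 0 0 h 0 \<in> L" by (simp add: defs)
  have "X0 - mat3 0 0 c 0 0 0 0 0 0 - mat3 0 b 0 0 0 f 0 0 0 - mat3 0 0 0 d 0 0 0 h 0 -
     mat3 0 0 0 0 0 0 g 0 0 \<in> L"
    by (intro cl mem 2 m2 1 m1)
  then have "mat3 a 0 0 0 e 0 0 0 i \<in> L" by (simp add: X0_def X_eq)
  with 2 m2 1 m1 show "mat3 0 0 (X$1$3) 0 0 0 0 0 0 \<in> L" "mat3 0 (X$1$2) 0 0 0 (X$2$3) 0 0 0 \<in> L"
    "mat3 (X$1$1) 0 0 0 (X$2$2) 0 0 0 (X$3$3) \<in> L" "mat3 0 0 0 (X$2$1) 0 0 0 (X$3$2) 0 \<in> L"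
    "mat3 0 0 0 0 0 0 (X$3$1) 0 0 \<in> L"
    by (simp_all add: X_eq)
qed

text \<open>The indices form the cycle 1, 2, 3, so brackets of neighbours give the opposite units
  E13, E32, E21, and brackets of opposite units give the diagonal part.\<close>

lemma generators_eq_sl3:
  assumes L: "lie_subalgebra L" "L \<subseteq> sl3"
    and gen: "mat3 0 1 0 0 0 0 0 0 0 \<in> L" "mat3 0 0 0 0 0 1 0 0 0 \<in> L" "mat3 0 0 0 0 0 0 1 0 0 \<in> L"
  shows "L = sl3"
proof
  note cl = lie_subalgebraD[OF L(1)]
  have e13: "mat3 0 0 1 0 0 0 0 0 0 \<in> L" using cl(4)[OF gen(1) gen(2)] by simp
  have e32: "mat3 0 0 0 0 0 0 0 1 0 \<in> L" using cl(4)[OF gen(3) gen(1)] by simp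
  have e21: "mat3 0 0 0 1 0 0 0 0 0 \<in> L" using cl(4)[OF gen(2) gen(3)] by simp
  have h1: "mat3 1 0 0 0 (-1) 0 0 0 0 \<in> L" using cl(4)[OF gen(1) e21] by simp
  have h2: "mat3 0 0 0 0 1 0 0 0 (-1) \<in> L" using cl(4)[OF gen(2) e32] by simp
  show "sl3 \<subseteq> L"
  proof
    fix A assume "A \<in> sl3"
    moreover obtain a b c d e f g h i where A: "A = mat3 a b c d e f g h i" by (rule mat3_cases)
    ultimately have "e = - a - i" by simp
    have "b *\<^sub>R mat3 0 1 0 0 0 0 0 0 0 + f *\<^sub>R mat3 0 0 0 0 0 1 0 0 0 + g *\<^sub>R mat3 0 0 0 0 0 0 1 0 0 +
        c *\<^sub>R mat3 0 0 1 0 0 0 0 0 0 + h *\<^sub>R mat3 0 0 0 0 0 0 0 1 0 + d *\<^sub>R mat3 0 0 0 1 0 0 0 0 0 +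
        a *\<^sub>R mat3 1 0 0 0 (-1) 0 0 0 0 + (- i) *\<^sub>R mat3 0 0 0 0 1 0 0 0 (-1) \<in> L"
      by (intro cl gen e13 e32 e21 h1 h2)
    then show "A \<in> L" by (simp add: A \<open>e = - a - i\<close>)
  qed
qed (fact L)

text \<open>When the corner entries vanish, the (3,1) entry of [A,B] is A32 B21 - B32 A21, so
  closure under brackets puts all the pairs (A21, A32) on one line.\<close>

lemma lower_triangle_proportional:
  fixes L :: "(real^3^3) set"
  assumes "lie_subalgebra L" "\<And>A. A \<in> L \<Longrightarrow> A $ 3 $ 1 = 0" "A \<in> L" "B \<in> L"
  shows "A $ 3 $ 2 * B $ 2 $ 1 = B $ 3 $ 2 * A $ 2 $ 1"
proof -
  have "lie_bracket A B $ 3 $ 1 = 0" "A $ 3 $ 1 = 0" "B $ 3 $ 1 = 0"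
    using assms lie_subalgebraD(4) by blast+
  then show ?thesis
    by (cases A rule: mat3_cases, cases B rule: mat3_cases) simp
qed

text \<open>Column 1 and row 3 each supply a nonzero subdiagonal entry, possibly in different
  matrices; proportionality puts both into one.\<close>

lemma lower_triangle_element:
  assumes irr: "irreducible_sl3_subalgebra L" and z: "\<And>A. A \<in> L \<Longrightarrow> A $ 3 $ 1 = 0"
  obtains A where "A \<in> L" "A $ 2 $ 1 \<noteq> 0" "A $ 3 $ 2 \<noteq> 0"
proof -
  obtain A1 i1 where A1: "A1 \<in> L" "i1 \<noteq> 1" "A1 $ i1 $ 1 \<noteq> 0"
    using irreducible_column[OF irr] by metis
  then have A1': "A1 $ 2 $ 1 \<noteq> 0" using z exhaust_3[of i1] by auto
  obtain A2 i2 where A2: "A2 \<in> L" "i2 \<noteq> 3" "A2 $ 3 $ i2 \<noteq> 0"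
    using irreducible_row[OF irr] by metis
  then have A2': "A2 $ 3 $ 2 \<noteq> 0" using z exhaust_3[of i2] by auto
  have "A1 $ 3 $ 2 \<noteq> 0"
    using lower_triangle_proportional[OF irreducible_sl3_subalgebraD(1)[OF irr] z A1(1) A2(1)] A1' A2'
    by auto
  then show thesis using that A1(1) A1' by blast
qed

text \<open>If all corners vanished, a double bracket built from E13 would have a subdiagonal pair
  off the common line.\<close>

lemma lower_corner_nonzero:
  assumes irr: "irreducible_sl3_subalgebra L" and N: "mat3 0 0 1 0 0 0 0 0 0 \<in> L"
  shows "\<exists>A\<in>L. A $ 3 $ 1 \<noteq> 0"
proof (rule ccontr)
  assume "\<not> ?thesis"
  then have z: "A $ 3 $ 1 = 0" if "A \<in> L" for A using that by blast
  note L = irreducible_sl3_subalgebraD(1)[OF irr]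
  note cl = lie_subalgebraD[OF L]
  obtain A1 where A1: "A1 \<in> L" "A1 $ 2 $ 1 \<noteq> 0" "A1 $ 3 $ 2 \<noteq> 0"
    using lower_triangle_element[OF irr z] .
  obtain p q r a s t b v where A: "A1 = mat3 p q r a s t 0 b v"
    using z[OF A1(1)] by (cases A1 rule: mat3_cases) auto
  have ab: "a \<noteq> 0" "b \<noteq> 0" using A1 by (simp_all add: A)
  \<comment> \<open>The bracket is -b E12 + a E23 plus a multiple of E13, and that multiple is
    subtracted.\<close>
  have "lie_bracket A1 (mat3 0 0 1 0 0 0 0 0 0) - (p - v) *\<^sub>R mat3 0 0 1 0 0 0 0 0 0 \<in> L"
    by (intro cl A1 N)
  then have "mat3 0 (-b) 0 0 0 a 0 0 0 \<in> L" by (simp add: A)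
  then have "lie_bracket (lie_bracket A1 (mat3 0 (-b) 0 0 0 a 0 0 0)) A1 \<in> L"
    by (intro cl A1)
  \<comment> \<open>The diagonal of the inner bracket is ab (1,-2,1), so the subdiagonal pair of the
    outer one is (-3 a^2 b, 3 a b^2), which has slope -b/a instead of b/a.\<close>
  from lower_triangle_proportional[OF L z this A1(1)] have "6 * (a * a * b * b) = 0"
    by (simp add: A algebra_simps)
  then show False using ab by simp
qed

lemma sl3_if_corner:
  assumes irr: "irreducible_sl3_subalgebra L" and N: "mat3 0 0 1 0 0 0 0 0 0 \<in> L"
  shows "L = sl3"
proof -
  obtain A where A: "A \<in> L" "A $ 3 $ 1 \<noteq> 0" using lower_corner_nonzero[OF assms] by blast
  obtain a b c d e f g h i where A_eq: "A = mat3 a b c d e f g h i" by (rule mat3_cases)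
  have g: "g \<noteq> 0" using A by (simp add: A_eq)
  note cl0 = lie_subalgebraD[OF irreducible_sl3_subalgebraD(1)[OF irr]]
  define x where "x = h / g"
  define y where "y = - d / g"
  have "(- 1 / g) *\<^sub>R lie_bracket A (mat3 0 0 1 0 0 0 0 0 0) + ((a - i) / g) *\<^sub>R mat3 0 0 1 0 0 0 0 0 0 \<in> L"
    by (intro cl0 A N)
  then have H: "mat3 1 x 0 0 0 y 0 0 (- 1) \<in> L" using g by (simp add: A_eq x_def y_def diff_divide_distrib)
  \<comment> \<open>The columns are eigenvectors of the upper triangular element just found, for 1,
    0, -1. Being unitriangular, P also commutes with E13.\<close>
  define P where "P = mat3 1 (- x) (x * y / 2) 0 1 (- y) 0 0 1"
  have "det P \<noteq> 0" by (simp add: P_def)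
  then obtain L' where L': "SL3_conjugate L L'"
    "\<And>X X'. X \<in> L \<Longrightarrow> X ** P = P ** X' \<Longrightarrow> X' \<in> L'"
    by (rule change_basis) blast
  have irr': "irreducible_sl3_subalgebra L'" using irreducible_sl3_subalgebra_conj[OF irr L'(1)] .
  have N': "mat3 0 0 1 0 0 0 0 0 0 \<in> L'" by (rule L'(2)[OF N]) (simp add: P_def)
  have H': "mat3 1 0 0 0 0 0 0 0 (- 1) \<in> L'" by (rule L'(2)[OF H]) (simp add: P_def)
  note L = irreducible_sl3_subalgebraD(1)[OF irr']
  note cl = lie_subalgebraD[OF L]
  note gr = mat3_gradation[OF L H']
  obtain B where B: "B \<in> L'" "B $ 3 $ 1 \<noteq> 0" using lower_corner_nonzero[OF irr' N'] by blast
  have "mat3 0 0 0 0 0 0 (B$3$1) 0 0 \<in> L'" using gr(5)[OF B(1)] .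
  from cl(3)[OF this, of "1 / B$3$1"] B(2) have M: "mat3 0 0 0 0 0 0 1 0 0 \<in> L'" by simp
  \<comment> \<open>Bracketing with E13 raises degree -1 to degree 1, so both subdiagonal and
    superdiagonal entries of X yield elements of degree 1.\<close>
  have deg1: "mat3 0 (X$1$2) 0 0 0 (X$2$3) 0 0 0 \<in> L'" "mat3 0 (X$3$2) 0 0 0 (- X$2$1) 0 0 0 \<in> L'"
    if "X \<in> L'" for X
  proof -
    show "mat3 0 (X$1$2) 0 0 0 (X$2$3) 0 0 0 \<in> L'" using gr(2)[OF that] .
    show "mat3 0 (X$3$2) 0 0 0 (- X$2$1) 0 0 0 \<in> L'"
      using cl(4)[OF N' gr(4)[OF that]] by simp
  qed
  obtain X1 i1 where X1: "X1 \<in> L'" "i1 \<noteq> 2" "X1 $ i1 $ 2 \<noteq> 0"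
    using irreducible_column[OF irr'] by metis
  then have "X1 $ 1 $ 2 \<noteq> 0 \<or> X1 $ 3 $ 2 \<noteq> 0" using exhaust_3[of i1] by auto
  then obtain p q where pq: "mat3 0 p 0 0 0 q 0 0 0 \<in> L'" "p \<noteq> 0"
    using deg1[OF X1(1)] that by fast
  obtain X2 i2 where X2: "X2 \<in> L'" "i2 \<noteq> 2" "X2 $ 2 $ i2 \<noteq> 0"
    using irreducible_row[OF irr'] by metis
  then have "- X2 $ 2 $ 1 \<noteq> 0 \<or> X2 $ 2 $ 3 \<noteq> 0" using exhaust_3[of i2] by auto
  then obtain r s where rs: "mat3 0 r 0 0 0 s 0 0 0 \<in> L'" "s \<noteq> 0"
    using deg1[OF X2(1)] that by fast
  obtain k l where kl: "mat3 0 k 0 0 0 l 0 0 0 \<in> L'" "k \<noteq> 0" "l \<noteq> 0"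
  proof (cases "q = 0 \<and> r = 0")
    case True
    then show thesis using cl(1)[OF pq(1) rs(1)] pq(2) rs(2) that by simp
  next
    case False
    then show thesis using pq rs that by blast
  qed
  \<comment> \<open>The result is kl diag(-1,2,-1); its adjoint action multiplies E12 by -3kl and
    E23 by 3kl, which separates the two.\<close>
  have "lie_bracket (mat3 0 k 0 0 0 l 0 0 0) (lie_bracket (mat3 0 0 0 0 0 0 1 0 0) (mat3 0 k 0 0 0 l 0 0 0)) \<in> L'"
    by (intro cl kl M)
  then have D: "mat3 (- (k * l)) 0 0 0 (2 * (k * l)) 0 0 0 (- (k * l)) \<in> L'"
    by (simp add: algebra_simps)
  have "(1 / (6 * k)) *\<^sub>R (3 *\<^sub>R mat3 0 k 0 0 0 l 0 0 0 -
      (1 / (k * l)) *\<^sub>R lie_bracket (mat3 (- (k * l)) 0 0 0 (2 * (k * l)) 0 0 0 (- (k * l))) (mat3 0 k 0 0 0 l 0 0 0)) \<in> L'"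
    by (intro cl kl D)
  then have e12: "mat3 0 1 0 0 0 0 0 0 0 \<in> L'" using kl by (simp add: field_simps)
  have "(1 / l) *\<^sub>R (mat3 0 k 0 0 0 l 0 0 0 - k *\<^sub>R mat3 0 1 0 0 0 0 0 0 0) \<in> L'"
    by (intro cl kl e12)
  then have e23: "mat3 0 0 0 0 0 1 0 0 0 \<in> L'" using kl by simp
  have "L' = sl3"
    using irr' by (intro generators_eq_sl3 L e12 e23 M) (simp add: irreducible_sl3_subalgebra_def)
  then show ?thesis using L'(1) SL3_conjugate_sl3 by blast
qed

lemma matrix_nonzero_vec:
  fixes A :: "real^'n^'m"
  assumes "A \<noteq> 0"
  obtains u where "A *v u \<noteq> 0"
  using assms by (metis matrix_eq matrix_vector_mult_0)

text \<open>Such an X has rank one. A basis w = Xu, c, u nearly brings it to E13, and correcting c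
  by a multiple of u finishes the normalisation.\<close>

lemma sl3_if_square_zero:
  assumes irr: "irreducible_sl3_subalgebra L" and X: "X \<in> L" "X \<noteq> 0" "X ** X = 0"
  shows "L = sl3"
proof -
  obtain u where u: "X *v u \<noteq> 0" using matrix_nonzero_vec[OF X(2)] .
  define w where "w = X *v u"
  have w: "w \<noteq> 0" "X *v w = 0" using u X(3) by (simp_all add: w_def matrix_vector_mul_assoc)
  have "card {w, u} \<le> 2" by (simp add: card_insert_if)
  then have "dim (span {w, u}) \<le> 2" by (metis dim_le_card' dim_span finite.emptyI finite.insertI order_trans)
  moreover have "dim (UNIV :: (real^3) set) = 3" by simp
  ultimately have "span {w, u} \<noteq> UNIV" by force
  then obtain c where c: "c \<notin> span {w, u}" by blast
  have "det (cols w c u) \<noteq> 0"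
  proof (rule det_cols_nonzero)
    fix x y z assume eq: "x *\<^sub>R w + y *\<^sub>R c + z *\<^sub>R u = 0"
    have "y = 0"
    proof (rule ccontr)
      assume "y \<noteq> 0"
      have "y *\<^sub>R c = - (x *\<^sub>R w + z *\<^sub>R u)"
        unfolding eq_neg_iff_add_eq_0 using eq by (simp add: add_ac)
      also have "\<dots> \<in> span {w, u}" by (intro span_neg span_add span_scale span_base) auto
      finally show False using c \<open>y \<noteq> 0\<close> by (metis span_scale scaleR_scaleR left_inverse scaleR_one)
    qed
    have "X *v (x *\<^sub>R w + y *\<^sub>R c + z *\<^sub>R u) = z *\<^sub>R w"
      by (simp add: \<open>y = 0\<close> matrix_vector_right_distrib matrix_vector_mult_scaleR w(2) w_def[symmetric])
    then have "z = 0" using eq w by simp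
    then show "x = 0 \<and> y = 0 \<and> z = 0" using eq w \<open>y = 0\<close> by simp
  qed
  then obtain g where g: "cols w c u ** g = mat 1" "g ** cols w c u = mat 1"
    by (auto simp: invertible_def simp flip: invertible_det_nz)
  define t where "t = g *v (X *v c)"
  have t: "X *v c = t$1 *\<^sub>R w + t$2 *\<^sub>R c + t$3 *\<^sub>R u"
  proof -
    have "cols w c u *v t = (cols w c u ** g) *v (X *v c)"
      unfolding t_def by (simp only: matrix_vector_mul_assoc matrix_mul_assoc)
    then have "cols w c u *v t = X *v c" by (simp add: g)
    then show ?thesis by (simp add: cols_mult_vec)
  qed
  define X' where "X' = mat3 0 (t$1) 1 0 (t$2) 0 0 (t$3) 0"
  have XP: "X ** cols w c u = cols w c u ** X'"
    by (simp add: mult_cols X'_def cols_mult_mat3 w t) (simp add: w_def)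
  have "cols w c u ** (X' ** X') = X ** (cols w c u ** X')"
    by (simp add: matrix_mul_assoc XP)
  also have "\<dots> = 0" unfolding XP[symmetric] by (simp add: matrix_mul_assoc X)
  finally have "(g ** cols w c u) ** (X' ** X') = 0" by (simp flip: matrix_mul_assoc)
  then have "X' ** X' = 0" by (simp add: g)
  then have "t$2 = 0" "t$3 = 0" by (auto simp: X'_def)
  then have X'_eq: "X' = mat3 0 (t$1) 1 0 0 0 0 0 0" by (simp add: X'_def)
  obtain L' where L': "SL3_conjugate L L'" "X' \<in> L'"
    using change_basis[OF \<open>det (cols w c u) \<noteq> 0\<close>] X(1) XP by metis
  \<comment> \<open>This basis change replaces c by c - t1 u, which X annihilates.\<close>
  have "det (mat3 1 0 0 0 1 0 0 (- t$1) 1) \<noteq> 0" by simp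
  then obtain L'' where L'': "SL3_conjugate L' L''"
    "\<And>X Y. X \<in> L' \<Longrightarrow> X ** mat3 1 0 0 0 1 0 0 (- t$1) 1 = mat3 1 0 0 0 1 0 0 (- t$1) 1 ** Y \<Longrightarrow> Y \<in> L''"
    by (rule change_basis) blast
  have conj: "SL3_conjugate L L''" using L'(1) L''(1) by (rule SL3_conjugate_trans)
  have "mat3 0 0 1 0 0 0 0 0 0 \<in> L''" by (rule L''(2)[OF L'(2)]) (simp add: X'_eq)
  then have "L'' = sl3" by (rule sl3_if_corner[OF irreducible_sl3_subalgebra_conj[OF irr conj]])
  then show ?thesis using conj SL3_conjugate_sl3 by blast
qed

text \<open>With square-zero elements excluded, any bracket that lands in the multiples of E13 must
  vanish; this controls the lower triangle.\<close>

lemma regular_nilpotent_entries: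
  assumes irr: "irreducible_sl3_subalgebra L" "L \<noteq> sl3" and N: "mat3 0 1 0 0 0 1 0 0 0 \<in> L"
  shows "A \<in> L \<Longrightarrow> A $ 3 $ 1 = 0" "A \<in> L \<Longrightarrow> A $ 3 $ 2 = A $ 2 $ 1"
    "\<exists>A\<in>L. A $ 2 $ 1 \<noteq> 0"
proof -
  note L = irreducible_sl3_subalgebraD(1)[OF irr(1)]
  note cl = lie_subalgebraD[OF L]
  show z: "A $ 3 $ 1 = 0" if A: "A \<in> L" for A
  proof -
    let ?T = "lie_bracket (mat3 0 1 0 0 0 1 0 0 0)"
    have "?T (?T (?T (?T A))) \<in> L" by (intro cl N A)
    \<comment> \<open>As N^3 = 0, only the middle term 6 N^2 A N^2 of the binomial expansion of
      (\<open>ad N\<close>)^4 survives, and N^2 = E13.\<close>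
    moreover have "?T (?T (?T (?T A))) = mat3 0 0 (6 * A $ 3 $ 1) 0 0 0 0 0 0"
      by (cases A rule: mat3_cases) simp
    ultimately show ?thesis
      using sl3_if_square_zero[OF irr(1), of "mat3 0 0 (6 * A $ 3 $ 1) 0 0 0 0 0 0"] irr(2) by auto
  qed
  obtain A where A: "A \<in> L" "A $ 2 $ 1 \<noteq> 0" "A $ 3 $ 2 \<noteq> 0"
    using lower_triangle_element[OF irr(1) z] .
  obtain p q r a s t b v where A_eq: "A = mat3 p q r a s t 0 b v"
    using z[OF A(1)] by (cases A rule: mat3_cases) auto
  have ab: "a \<noteq> 0" "b \<noteq> 0" using A by (simp_all add: A_eq)
  have "lie_bracket (lie_bracket (mat3 0 1 0 0 0 1 0 0 0) A) A \<in> L" by (intro cl A N)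
  \<comment> \<open>The subdiagonal pair of [[N,A],A] is (a(b - 2a), b(a - 2b)), which is
    proportional to (a, b) only if a = b.\<close>
  from lower_triangle_proportional[OF L z this A(1)] have "3 * (a * b) * (a - b) = 0"
    by (simp add: A_eq algebra_simps)
  then have "a = b" using ab by simp
  then show "B $ 3 $ 2 = B $ 2 $ 1" if "B \<in> L" for B
    using lower_triangle_proportional[OF L z that A(1)] ab by (simp add: A_eq)
  show "\<exists>A\<in>L. A $ 2 $ 1 \<noteq> 0" using A by blast
qed

lemma conjugate_u_3_17_if_regular_nilpotent:
  assumes irr: "irreducible_sl3_subalgebra L" "L \<noteq> sl3" and N: "mat3 0 1 0 0 0 1 0 0 0 \<in> L"
  shows "SL3_conjugate L u_3_17"
proof -
  note cl0 = lie_subalgebraD[OF irreducible_sl3_subalgebraD(1)[OF irr(1)]]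
  note ent0 = regular_nilpotent_entries[OF irr N]
  obtain A where A: "A \<in> L" "A $ 2 $ 1 \<noteq> 0" using ent0(3) by blast
  obtain p q r a s t v where A_eq: "A = mat3 p q r a s t 0 a v"
    using ent0(1,2)[OF A(1)] by (cases A rule: mat3_cases) auto
  have a: "a \<noteq> 0" using A by (simp add: A_eq)
  define x where "x = (s - p) / a"
  define y where "y = (v - s) / a"
  define k where "k = (t - q) / a"
  \<comment> \<open>The bracket is upper triangular with diagonal a (1,0,-1): up to its
    superdiagonal part it is the semisimple element of the principal sl2.\<close>
  have "(1 / a) *\<^sub>R lie_bracket (mat3 0 1 0 0 0 1 0 0 0) A \<in> L" by (intro cl0 A N)
  then have H0: "mat3 1 x k 0 0 y 0 0 (-1) \<in> L" using a by (simp add: A_eq x_def y_def k_def)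
  have "lie_bracket (mat3 1 x k 0 0 y 0 0 (-1)) (mat3 0 1 0 0 0 1 0 0 0) - mat3 0 1 0 0 0 1 0 0 0 \<in> L"
    by (intro cl0 H0 N)
  then have "mat3 0 0 (x - y) 0 0 0 0 0 0 \<in> L" by simp
  then have xy: "y = x" using sl3_if_square_zero[OF irr(1), of "mat3 0 0 (x - y) 0 0 0 0 0 0"] irr(2)
    by auto
  have "mat3 1 x k 0 0 y 0 0 (-1) - x *\<^sub>R mat3 0 1 0 0 0 1 0 0 0 \<in> L" by (intro cl0 H0 N)
  then have H1: "mat3 1 0 k 0 0 0 0 0 (-1) \<in> L" by (simp add: xy)
  \<comment> \<open>P commutes with N, so the basis change removes the entry k without disturbing
    N.\<close>
  define P where "P = mat3 1 0 (- k / 2) 0 1 0 0 0 1"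
  have "det P \<noteq> 0" by (simp add: P_def)
  then obtain L' where L': "SL3_conjugate L L'"
    "\<And>X X'. X \<in> L \<Longrightarrow> X ** P = P ** X' \<Longrightarrow> X' \<in> L'"
    by (rule change_basis) blast
  have irr': "irreducible_sl3_subalgebra L'" "L' \<noteq> sl3"
    using irreducible_sl3_subalgebra_conj[OF irr(1) L'(1)] L'(1) irr(2) SL3_conjugate_sl3 by blast+
  have N': "mat3 0 1 0 0 0 1 0 0 0 \<in> L'" by (rule L'(2)[OF N]) (simp add: P_def)
  have H: "mat3 1 0 0 0 0 0 0 0 (-1) \<in> L'" by (rule L'(2)[OF H1]) (simp add: P_def)
  note L = irreducible_sl3_subalgebraD(1)[OF irr'(1)]
  note cl = lie_subalgebraD[OF L]
  note ent = regular_nilpotent_entries[OF irr' N']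
  note gr = mat3_gradation[OF L H]
  have sqz: "X = 0" if "X \<in> L'" "X ** X = 0" for X
    using sl3_if_square_zero[OF irr'(1)] irr'(2) that by blast
  \<comment> \<open>Otherwise subtracting f N would leave a nonzero multiple of E12, whose square is
    zero.\<close>
  have deg1: "b = f" if "mat3 0 b 0 0 0 f 0 0 0 \<in> L'" for b f
  proof -
    have "mat3 0 b 0 0 0 f 0 0 0 - f *\<^sub>R mat3 0 1 0 0 0 1 0 0 0 \<in> L'" by (intro cl that N')
    then have "mat3 0 (b - f) 0 0 0 0 0 0 0 \<in> L'" by simp
    from sqz[OF this] show ?thesis by simp
  qed
  have "L' = u_3_17"
  proof
    show "L' \<subseteq> u_3_17"
    proof
      fix B assume B: "B \<in> L'"
      obtain a b c d e f g h i where B_eq: "B = mat3 a b c d e f g h i" by (rule mat3_cases)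
      have "c = 0" using sqz[OF gr(1)[OF B]] by (simp add: B_eq)
      have "b = f" using deg1[OF gr(2)[OF B]] by (simp add: B_eq)
      \<comment> \<open>The bracket of a diagonal element with N has degree 1, so it is a multiple
        of N; the diagonal is thus an arithmetic progression of sum zero.\<close>
      have "mat3 0 (a - e) 0 0 0 (e - i) 0 0 0 \<in> L'"
        using cl(4)[OF gr(3)[OF B] N'] by (simp add: B_eq)
      then have "a - e = e - i" by (rule deg1)
      moreover have "a + e + i = 0"
        using irreducible_sl3_subalgebraD(2)[OF irr'(1) B] by (simp add: B_eq)
      ultimately have "e = 0" "i = - a" by simp_all
      moreover have "g = 0" "h = d" using ent(1,2)[OF B] by (simp_all add: B_eq)
      ultimately show "B \<in> u_3_17" using \<open>c = 0\<close> \<open>b = f\<close> by (auto simp: u_3_17_eq B_eq)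
    qed
    obtain A where A: "A \<in> L'" "A $ 2 $ 1 \<noteq> 0" using ent(3) by blast
    have "(1 / A $ 2 $ 1) *\<^sub>R mat3 0 0 0 (A$2$1) 0 0 0 (A$3$2) 0 \<in> L'" by (intro cl gr A)
    then have Y: "mat3 0 0 0 1 0 0 0 1 0 \<in> L'" using A ent(2)[OF A(1)] by simp
    show "u_3_17 \<subseteq> L'"
    proof
      fix B assume "B \<in> u_3_17"
      then obtain a b c where B: "B = mat3 c a 0 b 0 a 0 b (- c)" by (auto simp: u_3_17_eq)
      have "a *\<^sub>R mat3 0 1 0 0 0 1 0 0 0 + b *\<^sub>R mat3 0 0 0 1 0 0 0 1 0 +
          c *\<^sub>R mat3 1 0 0 0 0 0 0 0 (-1) \<in> L'"
        by (intro cl N' Y H)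
      then show "B \<in> L'" by (simp add: B)
    qed
  qed
  then show ?thesis using L'(1) by simp
qed

text \<open>X^2 is nonzero, so X^2 u, X u, u is a Jordan basis for a suitable u.\<close>

lemma conjugate_u_3_17_if_nilpotent:
  assumes irr: "irreducible_sl3_subalgebra L" "L \<noteq> sl3"
    and X: "X \<in> L" "X \<noteq> 0" "X ** X ** X = 0"
  shows "SL3_conjugate L u_3_17"
proof -
  have "X ** X \<noteq> 0" using sl3_if_square_zero[OF irr(1) X(1,2)] irr(2) by blast
  then obtain u where u: "(X ** X) *v u \<noteq> 0" by (rule matrix_nonzero_vec)
  define a where "a = X *v (X *v u)"
  have a: "a \<noteq> 0" using u by (simp add: a_def matrix_vector_mul_assoc)
  have Xa: "X *v a = 0" using X(3) by (simp add: a_def matrix_vector_mul_assoc matrix_mul_assoc)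
  let ?P = "cols a (X *v u) u"
  have "det ?P \<noteq> 0"
  proof (rule det_cols_nonzero)
    fix x y z assume eq: "x *\<^sub>R a + y *\<^sub>R (X *v u) + z *\<^sub>R u = 0"
    note lin = matrix_vector_right_distrib matrix_vector_mult_scaleR Xa a_def[symmetric]
    have "X *v (X *v (x *\<^sub>R a + y *\<^sub>R (X *v u) + z *\<^sub>R u)) = z *\<^sub>R a" by (simp add: lin)
    then have "z = 0" using eq a by simp
    have "X *v (x *\<^sub>R a + y *\<^sub>R (X *v u) + z *\<^sub>R u) = y *\<^sub>R a" by (simp add: lin \<open>z = 0\<close>)
    then have "y = 0" using eq a by simp
    then show "x = 0 \<and> y = 0 \<and> z = 0" using eq a \<open>z = 0\<close> by simp
  qed
  moreover have "X ** ?P = ?P ** mat3 0 1 0 0 0 1 0 0 0"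
    by (simp add: mult_cols cols_mult_mat3 Xa flip: a_def)
  ultimately obtain L' where L': "SL3_conjugate L L'" "mat3 0 1 0 0 0 1 0 0 0 \<in> L'"
    using change_basis[of ?P L] X(1) by metis
  have "SL3_conjugate L' u_3_17"
    using irreducible_sl3_subalgebra_conj[OF irr(1) L'(1)] L' irr(2) SL3_conjugate_sl3
    by (intro conjugate_u_3_17_if_regular_nilpotent) auto
  then show ?thesis using L'(1) SL3_conjugate_trans by blast
qed

section \<open>Irreducible subalgebras without nilpotent elements\<close>

text \<open>For traceless X the two equations say that X is nilpotent; as equations in invariants
  they need no powers or eigenvectors.\<close>

definition nilpotent_free :: "(real^3^3) set \<Rightarrow> bool" where
  "nilpotent_free L \<longleftrightarrow> (\<forall>X\<in>L. trace (X ** X) = 0 \<longrightarrow> det X = 0 \<longrightarrow> X = 0)"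

text \<open>Cayley-Hamilton: for trace 0 the second elementary symmetric function of the eigenvalues
  is -tr(X^2)/2.\<close>

lemma cube_traceless:
  fixes X :: "real^3^3"
  assumes "trace X = 0"
  shows "X ** X ** X = (trace (X ** X) / 2) *\<^sub>R X + det X *\<^sub>R mat 1"
proof -
  obtain a b c d e f g h i where X: "X = mat3 a b c d e f g h i" by (rule mat3_cases)
  then have "i = - a - e" using assms by simp
  then show ?thesis by (simp add: X mat3_one) (intro conjI; simp add: field_simps)
qed

lemma nilpotent_free_conj:
  assumes "nilpotent_free L" "SL3_conjugate L L'"
  shows "nilpotent_free L'"
proof -
  obtain g h where gh: "g ** h = mat 1" "h ** g = mat 1" and L': "L' = conjm g h ` L"
    using assms(2) by (auto simp: SL3_conjugate_iff)
  have "conjm g h 0 = 0" by (simp add: conjm_def)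
  then show ?thesis
    using assms(1) unfolding nilpotent_free_def L'
    by (auto simp: det_conjm[OF gh(2)] trace_conjm[OF gh(2)] simp flip: conjm_mult[OF gh(2)])
qed

section \<open>Simple real eigenvalues and block diagonal form\<close>

lemma depressed_cubic_root:
  fixes c d :: real
  obtains x where "x ^ 3 + c * x - d = 0"
proof -
  define M where "M = 1 + \<bar>c\<bar> + \<bar>d\<bar>"
  let ?f = "\<lambda>x. x ^ 3 + c * x - d"
  have M: "M \<ge> 1" by (simp add: M_def)
  have "\<bar>c\<bar> * M + \<bar>d\<bar> \<le> \<bar>c\<bar> * M + \<bar>d\<bar> * M" using M by (simp add: mult_le_cancel_left1)
  also have "\<dots> \<le> M * M" using M by (simp add: M_def algebra_simps)
  also have "\<dots> \<le> M ^ 3" using M by (simp add: power3_eq_cube)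
  finally have bound: "\<bar>c\<bar> * M + \<bar>d\<bar> \<le> M ^ 3" .
  have "\<bar>c * M\<bar> = \<bar>c\<bar> * M" using M by (simp add: abs_mult)
  then have "?f (- M) \<le> 0" "0 \<le> ?f M" using bound by auto
  moreover have "\<forall>x. - M \<le> x \<and> x \<le> M \<longrightarrow> isCont ?f x" by (auto intro!: continuous_intros)
  ultimately have "\<exists>x. - M \<le> x \<and> x \<le> M \<and> ?f x = 0" using M by (intro IVT) auto
  then show thesis using that by blast
qed

text \<open>The nonvanishing expression is the derivative of the characteristic polynomial at l. The
  roots sum to 0, so a double root l is accompanied by -2l, which is simple unless l = 0; a triple
  root 0 is what the second assumption excludes.\<close>

lemma simple_real_eigenvalue:
  fixes X :: "real^3^3"
  assumes "trace X = 0" "trace (X ** X) \<noteq> 0 \<or> det X \<noteq> 0"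
  obtains l where "det (X - l *\<^sub>R mat 1) = 0" "3 * l\<^sup>2 - trace (X ** X) / 2 \<noteq> 0"
proof -
  define c where "c = - trace (X ** X) / 2"
  obtain x11 x12 x13 x21 x22 x23 x31 x32 x33 where
    X: "X = mat3 x11 x12 x13 x21 x22 x23 x31 x32 x33" by (rule mat3_cases)
  have charpoly: "det (X - l *\<^sub>R mat 1) = - (l ^ 3 + c * l - det X)" for l
  proof -
    have "x33 = - x11 - x22" using assms(1) by (simp add: X)
    then show ?thesis
      by (simp add: X mat3_one c_def) (simp add: field_simps power3_eq_cube)
  qed
  obtain l where l: "l ^ 3 + c * l - det X = 0" by (rule depressed_cubic_root)
  show thesis
  proof (cases "3 * l\<^sup>2 + c = 0")
    case False
    then show thesis using that[of l] l charpoly[of l] by (simp add: c_def)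
  next
    case True
    then have c: "c = - 3 * l\<^sup>2" by simp
    have d: "det X = - 2 * l ^ 3" using l by (simp add: c power2_eq_square power3_eq_cube)
    have "l \<noteq> 0" using assms(2) c d by (auto simp: c_def)
    moreover have "det (X - (- 2 * l) *\<^sub>R mat 1) = 0"
      unfolding charpoly by (simp add: c d power2_eq_square power3_eq_cube)
    ultimately show thesis using that[of "- 2 * l"] c by (simp add: c_def power_mult_distrib)
  qed
qed

lemma extend_to_basis:
  fixes v :: "real^3"
  assumes "v \<noteq> 0"
  obtains a b where "det (cols a b v) \<noteq> 0"
proof -
  have "v$1 \<noteq> 0 \<or> v$2 \<noteq> 0 \<or> v$3 \<noteq> 0" using assms by (auto simp: vec_eq_iff forall_3)
  moreover have "det (cols (vector [0,1,0]) (vector [0,0,1]) v) = v$1"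
    "det (cols (vector [1,0,0]) (vector [0,0,1]) v) = - v$2"
    "det (cols (vector [1,0,0]) (vector [0,1,0]) v) = v$3"
    by (simp_all add: cols_def)
  ultimately show thesis using that by (metis neg_equal_0_iff_equal)
qed

lemma eigenvector_exists:
  fixes X :: "real^'n^'n"
  assumes "det (X - l *\<^sub>R mat 1) = 0"
  obtains v where "v \<noteq> 0" "X *v v = l *\<^sub>R v"
proof -
  obtain v where v: "v \<noteq> 0" "(X - l *\<^sub>R mat 1) *v v = 0"
    using assms by (metis invertible_det_nz invertible_left_inverse matrix_left_invertible_ker)
  moreover have "(X - l *\<^sub>R mat 1) *v v = X *v v - l *\<^sub>R v"
    by (simp add: matrix_vector_mult_diff_rdistrib scaleR_matrix_vector_assoc[symmetric])
  ultimately show thesis using that by simp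
qed

text \<open>The eigenvector as third column makes the matrix block triangular. Simplicity of l means
  that it is no eigenvalue of the 2 x 2 block, so the remaining row can be cleared.\<close>

lemma block_diagonal_conjugate:
  assumes X: "X \<in> L" "X \<noteq> 0" "trace X = 0" and nil: "nilpotent_free L"
  obtains L' p q r s l where "SL3_conjugate L L'" "mat3 p q 0 r s 0 0 0 l \<in> L'" "p + s + l = 0"
    "(p - l) * (s - l) - q * r \<noteq> 0" "trace (X ** X) = p\<^sup>2 + s\<^sup>2 + l\<^sup>2 + 2 * q * r"
    "det X = (p * s - q * r) * l"
proof -
  obtain l where l: "det (X - l *\<^sub>R mat 1) = 0" "3 * l\<^sup>2 - trace (X ** X) / 2 \<noteq> 0"
    using simple_real_eigenvalue[OF X(3)] X nil unfolding nilpotent_free_def by metis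
  obtain v where v: "v \<noteq> 0" "X *v v = l *\<^sub>R v" using eigenvector_exists[OF l(1)] .
  obtain a b where P: "det (cols a b v) \<noteq> 0" using extend_to_basis[OF v(1)] .
  then obtain g where g: "cols a b v ** g = mat 1" "g ** cols a b v = mat 1"
    by (auto simp: invertible_def simp flip: invertible_det_nz)
  define Y where "Y = conjm g (cols a b v) X"
  have XP: "X ** cols a b v = cols a b v ** Y"
    by (simp add: Y_def conjm_def matrix_mul_assoc g)
  obtain L1 where L1: "SL3_conjugate L L1" "Y \<in> L1"
    using change_basis[OF P] X(1) XP by metis
  obtain p q e r s f t u m where Y: "Y = mat3 p q e r s f t u m" by (rule mat3_cases)
  have "cols a b v *v vector [e, f, m - l] = 0"
    using XP v(2) by (simp add: Y mult_cols cols_mult_mat3 cols_mult_vec)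
      (simp add: cols_def vec_eq_iff forall_3 algebra_simps)
  moreover have "z = 0" if "cols a b v *v z = 0" for z
    by (metis that g(2) matrix_vector_mul_assoc matrix_vector_mul_lid matrix_vector_mult_0_right)
  ultimately have "vector [e, f, m - l] = (0 :: real^3)" by blast
  then have ef: "e = 0" "f = 0" "m = l" by (simp_all add: vec_eq_iff forall_3)
  have "trace (Y ** Y) = trace (X ** X)" "det Y = det X" "trace Y = 0"
    using X(3) by (simp_all add: Y_def trace_conjm det_conjm g flip: conjm_mult)
  then have inv: "trace (X ** X) = p\<^sup>2 + s\<^sup>2 + l\<^sup>2 + 2 * q * r" "det X = (p * s - q * r) * l"
    "p + s + l = 0"
    by (simp_all add: Y ef power2_eq_square algebra_simps)
  define D where "D = (p - l) * (s - l) - q * r"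
  have "s = - p - l" using inv(3) by simp
  \<comment> \<open>Both sides are the derivative of the characteristic polynomial at l.\<close>
  then have "D = 3 * l\<^sup>2 - trace (X ** X) / 2"
    by (simp add: D_def inv(1)) (simp add: field_simps power2_eq_square)
  then have D: "D \<noteq> 0" using l(2) by simp
  \<comment> \<open>Cramer's rule for (x, y)(B - l) = (t, u), where B is the 2 x 2 block with
    determinant D of B - l.\<close>
  define x where "x = (t * (s - l) - u * r) / D"
  define y where "y = (u * (p - l) - t * q) / D"
  have "D * x = t * (s - l) - u * r" "D * y = u * (p - l) - t * q" using D by (simp_all add: x_def y_def)
  then have "D * (x * (p - l) + y * r) = D * t" "D * (x * q + y * (s - l)) = D * u"
    using D_def by algebra+
  then have xy: "x * (p - l) + y * r = t" "x * q + y * (s - l) = u" using D by simp_all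
  have "det (mat3 1 0 0 0 1 0 x y 1) \<noteq> 0" by simp
  then obtain L2 where L2: "SL3_conjugate L1 L2"
    "\<And>X Z. X \<in> L1 \<Longrightarrow> X ** mat3 1 0 0 0 1 0 x y 1 = mat3 1 0 0 0 1 0 x y 1 ** Z \<Longrightarrow> Z \<in> L2"
    by (rule change_basis) blast
  have "mat3 p q 0 r s 0 0 0 l \<in> L2"
    by (rule L2(2)[OF L1(2)]) (use xy in \<open>simp add: Y ef algebra_simps\<close>)
  then show thesis using that SL3_conjugate_trans[OF L1(1) L2(1)] inv D D_def by blast
qed

section \<open>Eigenvalues of \<open>ad A\<close> in the absence of nilpotents\<close>

lemma linear_inj_on_subspace_onto:
  fixes f :: "'a::euclidean_space \<Rightarrow> 'a"
  assumes "linear f" "subspace S" "f ` S \<subseteq> S" "inj_on f S"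
  shows "f ` S = S"
proof (rule subspace_dim_equal)
  show "subspace (f ` S)" using assms linear_subspace_image by blast
  show "dim S \<le> dim (f ` S)" using assms by (simp add: dim_image_eq span_eq_iff[THEN iffD2])
qed (use assms in auto)

text \<open>For B commuting with X, \<alpha> tr(BX) = tr(B[A,X]) = 0. Taking B = X and B = X^2 gives
  tr(X^2) = tr(X^3) = 0, so X is nilpotent.\<close>

lemma eigenvector_of_bracket_eq_0:
  assumes nil: "nilpotent_free L" and X: "X \<in> L" "trace X = 0"
    and eig: "lie_bracket A X = \<alpha> *\<^sub>R X" "\<alpha> \<noteq> 0"
  shows "X = 0"
proof -
  have AX: "A ** X - X ** A = \<alpha> *\<^sub>R X" using eig by (simp add: lie_bracket_def)
  have tr: "trace (B ** X) = 0" if "B ** X = X ** B" for B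
  proof -
    have "\<alpha> * trace (B ** X) = trace (B ** (\<alpha> *\<^sub>R X))"
      by (simp add: matrix_scaleR_right) (simp add: trace_def sum_distrib_left)
    also have "\<dots> = trace (B ** A ** X) - trace (B ** X ** A)"
      by (simp add: AX[symmetric] matrix_diff_right trace_sub matrix_mul_assoc)
    also have "trace (B ** X ** A) = trace (X ** (B ** A))" by (simp add: that matrix_mul_assoc)
    also have "\<dots> = trace (B ** A ** X)" by (rule trace_mul_sym)
    finally show ?thesis using eig(2) by simp
  qed
  have t2: "trace (X ** X) = 0" by (rule tr) simp
  have "trace (X ** X ** X) = 0" by (rule tr) (simp add: matrix_mul_assoc)
  then have "det X = 0" by (simp add: cube_traceless[OF X(2)] t2 trace_add) (simp add: mat3_one)
  then show ?thesis using nil X t2 unfolding nilpotent_free_def by blast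
qed

text \<open>9 l^2 - 4 D is the discriminant of B - l, through which \<open>ad A\<close> acts on the
  off-diagonal third column. Real eigenvalues \<alpha>, \<beta> would make \<open>ad A\<close> -
  \<alpha> and \<open>ad A\<close> - \<beta> bijective on L, while their product kills that
  column.\<close>

lemma block_diagonal_not_real:
  assumes irr: "irreducible_sl3_subalgebra L" and nil: "nilpotent_free L"
    and A: "mat3 p q 0 r s 0 0 0 l \<in> L" and D: "(p - l) * (s - l) - q * r \<noteq> 0"
  shows "9 * l\<^sup>2 < 4 * ((p - l) * (s - l) - q * r)"
proof (rule ccontr)
  define D where "D = (p - l) * (s - l) - q * r"
  define A where "A = mat3 p q 0 r s 0 0 0 l"
  assume "\<not> ?thesis"
  then have disc: "9 * l\<^sup>2 - 4 * D \<ge> 0" by (simp add: D_def)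
  define \<delta> where "\<delta> = sqrt (9 * l\<^sup>2 - 4 * D)"
  have \<delta>: "\<delta> * \<delta> = 9 * l\<^sup>2 - 4 * D" using disc by (simp add: \<delta>_def)
  \<comment> \<open>The roots of the characteristic polynomial t^2 + 3l t + D of B - l; they are
    nonzero because D is.\<close>
  define \<alpha> where "\<alpha> = (- 3 * l + \<delta>) / 2"
  define \<beta> where "\<beta> = (- 3 * l - \<delta>) / 2"
  have s: "s = - p - l" using irreducible_sl3_subalgebraD(2)[OF irr assms(3)] by simp
  have ab: "\<beta> = - 3 * l - \<alpha>" by (simp add: \<alpha>_def \<beta>_def field_simps)
  have "\<alpha> * \<beta> = (9 * l\<^sup>2 - \<delta> * \<delta>) / 4" by (simp add: \<alpha>_def \<beta>_def field_simps power2_eq_square)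
  then have "\<alpha> * \<beta> = D" using \<delta> by simp
  then have nz: "\<alpha> \<noteq> 0" "\<beta> \<noteq> 0" and root: "\<alpha> * (- 3 * l - \<alpha>) = (p - l) * (- p - l - l) - q * r"
    using D by (auto simp: D_def ab s)
  define f where "f = (\<lambda>k X. lie_bracket A X - k *\<^sub>R X)"
  note L = irreducible_sl3_subalgebraD(1)[OF irr]
  have onto: "f k ` L = L" if "k \<noteq> 0" for k
  proof (rule linear_inj_on_subspace_onto)
    show lin: "linear (f k)"
      by (rule linearI) (simp_all add: f_def lie_bracket_linear_simps algebra_simps)
    show "subspace L" using L by (simp add: lie_subalgebra_def)
    show "f k ` L \<subseteq> L"
      using lie_subalgebraD[OF L] assms(3) by (auto simp: f_def A_def)
    have "X = 0" if "X \<in> L" "f k X = 0" for X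
      using eigenvector_of_bracket_eq_0[OF nil \<open>X \<in> L\<close> _ _ \<open>k \<noteq> 0\<close>, of A] that
        irreducible_sl3_subalgebraD(2)[OF irr] by (simp add: f_def)
    then show "inj_on (f k) L"
      using linear_injective_on_subspace_0[OF lin \<open>subspace L\<close>] by blast
  qed
  have upper: "f \<alpha> (f \<beta> X) $ 1 $ 3 = 0 \<and> f \<alpha> (f \<beta> X) $ 2 $ 3 = 0" for X
  proof -
    obtain a b c d e c' g h i where X: "X = mat3 a b c d e c' g h i" by (rule mat3_cases)
    have "f \<alpha> (f \<beta> X) $ 1 $ 3 = (p - l) * ((p - l) * c + q * c') + q * (r * c + (s - l) * c') +
        3 * l * ((p - l) * c + q * c') + \<alpha> * (- 3 * l - \<alpha>) * c"
      by (simp add: X f_def A_def ab algebra_simps)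
    also have "\<dots> = 0" using root s by algebra
    finally have 1: "f \<alpha> (f \<beta> X) $ 1 $ 3 = 0" .
    have "f \<alpha> (f \<beta> X) $ 2 $ 3 = r * ((p - l) * c + q * c') + (s - l) * (r * c + (s - l) * c') +
        3 * l * (r * c + (s - l) * c') + \<alpha> * (- 3 * l - \<alpha>) * c'"
      by (simp add: X f_def A_def ab algebra_simps)
    also have "\<dots> = 0" using root s by algebra
    finally show ?thesis using 1 by simp
  qed
  have "X $ 1 $ 3 = 0 \<and> X $ 2 $ 3 = 0" if "X \<in> L" for X
  proof -
    have "X \<in> f \<alpha> ` f \<beta> ` L" using onto nz that by simp
    then show ?thesis using upper by auto
  qed
  then show False using irreducible_column[OF irr, of 3] by (metis exhaust_3)
qed

text \<open>For l nonzero, polynomials in \<open>ad A\<close> first clear the third column and then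
  show that the off-diagonal third row vanishes throughout L, against irreducibility.\<close>

lemma block_diagonal_eigenvalue_0:
  assumes irr: "irreducible_sl3_subalgebra L" and nil: "nilpotent_free L"
    and A: "mat3 p q 0 r s 0 0 0 l \<in> L" and D: "(p - l) * (s - l) - q * r \<noteq> 0"
  shows "l = 0"
proof (rule ccontr)
  assume "l \<noteq> 0"
  note cl = lie_subalgebraD[OF irreducible_sl3_subalgebraD(1)[OF irr]]
  have s: "s = - p - l" using irreducible_sl3_subalgebraD(2)[OF irr A] by simp
  define D where "D = (p - l) * (s - l) - q * r"
  have disc: "9 * l\<^sup>2 < 4 * D"
    unfolding D_def by (rule block_diagonal_not_real[OF irr nil A D])
  have "p * s - q * r = D - 2 * l\<^sup>2" by (simp add: D_def s power2_eq_square algebra_simps)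
  moreover have "D - 2 * l\<^sup>2 > 0" using disc \<open>l \<noteq> 0\<close> by (smt (verit) zero_less_power2)
  ultimately have detB: "p * s - q * r \<noteq> 0" by simp
  let ?T = "lie_bracket (mat3 p q 0 r s 0 0 0 l)"
  have row_zero: "X $ 3 $ 1 = 0 \<and> X $ 3 $ 2 = 0" if X: "X \<in> L" "X $ 1 $ 3 = 0" "X $ 2 $ 3 = 0" for X
  proof -
    obtain a b d e x y i where X_eq: "X = mat3 a b 0 d e 0 x y i"
      using X(2,3) by (cases X rule: mat3_cases) auto
    \<comment> \<open>On the 2 x 2 block \<open>ad A\<close> satisfies t^3 = (9 l^2 - 4 D) t, so
      only the third row survives, where this polynomial is -3D times right multiplication by B. A
      matrix living in that row alone is nilpotent.\<close>
    define Z where "Z = ?T (?T (?T X)) - (9 * l\<^sup>2 - 4 * D) *\<^sub>R ?T X"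
    have "Z \<in> L" unfolding Z_def by (intro cl A X(1))
    moreover have Z: "Z = mat3 0 0 0 0 0 0 (- 3 * D * (x * p + y * r)) (- 3 * D * (x * q + y * s)) 0"
      by (simp add: Z_def X_eq D_def s) (intro conjI; simp add: power2_eq_square algebra_simps)
    ultimately have "Z = 0" using nil by (auto simp: nilpotent_free_def)
    then have "x * p + y * r = 0" "x * q + y * s = 0" using D by (auto simp: Z D_def)
    moreover have "x * (p * s - q * r) = (x * p + y * r) * s - (x * q + y * s) * r"
      "y * (p * s - q * r) = (x * q + y * s) * p - (x * p + y * r) * q"
      by (simp_all add: algebra_simps)
    ultimately have "x * (p * s - q * r) = 0" "y * (p * s - q * r) = 0" by simp_all
    then show ?thesis using detB by (simp add: X_eq)
  qed
  have "X $ 3 $ 1 = 0 \<and> X $ 3 $ 2 = 0" if X: "X \<in> L" for X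
  proof -
    obtain a b c d e f x y i where X_eq: "X = mat3 a b c d e f x y i" by (rule mat3_cases)
    \<comment> \<open>By Cayley-Hamilton for B - l this kills the off-diagonal third column; on the
      third row it is -6l times right multiplication by B - l.\<close>
    define Y where "Y = ?T (?T X) + (3 * l) *\<^sub>R ?T X + D *\<^sub>R X"
    have "Y \<in> L" unfolding Y_def by (intro cl A X)
    moreover have "Y $ 1 $ 3 = 0" "Y $ 2 $ 3 = 0"
      by (simp_all add: Y_def X_eq D_def s algebra_simps)
    ultimately have "Y $ 3 $ 1 = 0" "Y $ 3 $ 2 = 0" using row_zero by blast+
    moreover have "Y $ 3 $ 1 = - 6 * l * (x * (p - l) + y * r)" "Y $ 3 $ 2 = - 6 * l * (x * q + y * (s - l))"
      by (simp_all add: Y_def X_eq D_def s algebra_simps)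
    ultimately have "x * (p - l) + y * r = 0" "x * q + y * (s - l) = 0" using \<open>l \<noteq> 0\<close> by auto
    moreover have "x * D = (x * (p - l) + y * r) * (s - l) - (x * q + y * (s - l)) * r"
      "y * D = (x * q + y * (s - l)) * (p - l) - (x * (p - l) + y * r) * q"
      by (simp_all add: D_def algebra_simps)
    ultimately have "x * D = 0" "y * D = 0" by simp_all
    then show ?thesis using D by (simp add: X_eq D_def)
  qed
  moreover obtain X j where "X \<in> L" "j \<noteq> 3" "X $ 3 $ j \<noteq> 0" using irreducible_row[OF irr] by metis
  ultimately show False using exhaust_3[of j] by auto
qed

lemma nilpotent_free_rotation:
  assumes irr: "irreducible_sl3_subalgebra L" and nil: "nilpotent_free L" and X: "X \<in> L" "X \<noteq> 0"
  shows "det X = 0" "trace (X ** X) < 0"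
    "\<exists>L'. SL3_conjugate L L' \<and> mat3 0 (-1) 0 1 0 0 0 0 0 \<in> L'"
proof -
  obtain L' p q r s l where L': "SL3_conjugate L L'" and A: "mat3 p q 0 r s 0 0 0 l \<in> L'" "p + s + l = 0"
    "(p - l) * (s - l) - q * r \<noteq> 0" "trace (X ** X) = p\<^sup>2 + s\<^sup>2 + l\<^sup>2 + 2 * q * r"
    "det X = (p * s - q * r) * l"
    using block_diagonal_conjugate[OF X irreducible_sl3_subalgebraD(2)[OF irr X(1)] nil] by metis
  have irr': "irreducible_sl3_subalgebra L'" using irr L' irreducible_sl3_subalgebra_conj by blast
  have nil': "nilpotent_free L'" using nil L' nilpotent_free_conj by blast
  have l: "l = 0" using block_diagonal_eigenvalue_0[OF irr' nil' A(1,3)] .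
  then have s: "s = - p" using A(2) by simp
  have pos: "- (p * p) - q * r > 0"
    using block_diagonal_not_real[OF irr' nil' A(1,3)] by (simp add: l s)
  then have "r \<noteq> 0" by (auto simp: not_less)
  show "det X = 0" "trace (X ** X) < 0" using A(4,5) pos by (simp_all add: l s power2_eq_square)
  define b where "b = sqrt (- (p * p) - q * r)"
  have b: "b \<noteq> 0" "b * b = - (p * p) - q * r" using pos by (simp_all add: b_def)
  have bb: "p * (p / b) + q * (r / b) = - b" using b by (simp add: field_simps)
  \<comment> \<open>The first two columns are e1 and A e1 / b. Since A^2 = -b^2 on their span, A / b
    becomes the quarter turn.\<close>
  define P where "P = mat3 1 (p / b) 0 0 (r / b) 0 0 0 1"
  have "det P \<noteq> 0" using b \<open>r \<noteq> 0\<close> by (simp add: P_def)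
  moreover have "((1 / b) *\<^sub>R mat3 p q 0 r s 0 0 0 l) ** P = P ** mat3 0 (-1) 0 1 0 0 0 0 0"
    using b(1) bb by (simp add: P_def l s) (simp add: field_simps)
  moreover have "(1 / b) *\<^sub>R mat3 p q 0 r s 0 0 0 l \<in> L'"
    using lie_subalgebraD(3)[OF irreducible_sl3_subalgebraD(1)[OF irr'] A(1)] .
  ultimately obtain L'' where "SL3_conjugate L' L''" "mat3 0 (-1) 0 1 0 0 0 0 0 \<in> L''"
    using change_basis[of P L'] by metis
  then show "\<exists>L'. SL3_conjugate L L' \<and> mat3 0 (-1) 0 1 0 0 0 0 0 \<in> L'"
    using L' SL3_conjugate_trans by blast
qed

text \<open>The right-hand side consists of the matrices skew for the definite form x^2 + y^2 -
  z^2/c. Components of L under the square of \<open>ad J\<close>, with eigenvalues 0, -1, -4, are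
  examined separately.\<close>

lemma rotation_algebra:
  assumes irr: "irreducible_sl3_subalgebra L" and nil: "nilpotent_free L"
    and J: "mat3 0 (-1) 0 1 0 0 0 0 0 \<in> L"
  obtains c where "c < 0" "L = {mat3 0 (- a) v a 0 w (c * v) (c * w) 0 | a v w. True}"
proof -
  note cl = lie_subalgebraD[OF irreducible_sl3_subalgebraD(1)[OF irr]]
  note neg = nilpotent_free_rotation(1,2)[OF irr nil]
  let ?T = "lie_bracket (mat3 0 (-1) 0 1 0 0 0 0 0)"
  have shape: "X$1$1 = 0 \<and> X$2$2 = 0 \<and> X$3$3 = 0 \<and> X$1$2 = - X$2$1 \<and>
      mat3 0 0 (X$1$3) 0 0 (X$2$3) (X$3$1) (X$3$2) 0 \<in> L" if X: "X \<in> L" for X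
  proof -
    obtain a b v d e w x y i where X_eq: "X = mat3 a b v d e w x y i" by (rule mat3_cases)
    have i: "i = - a - e" using irreducible_sl3_subalgebraD(2)[OF irr X] by (simp add: X_eq)
    let ?X0 = "mat3 ((a+e)/2) (- (d-b)/2) 0 ((d-b)/2) ((a+e)/2) 0 0 0 (- (a+e))"
    \<comment> \<open>Component for eigenvalue 0 of t = (\<open>ad J\<close>)^2: t^2/4 + 5t/4 + 1
      equals 1 at 0 and vanishes at -1 and -4.\<close>
    have "(1/4) *\<^sub>R ?T (?T (?T (?T X))) + (5/4) *\<^sub>R ?T (?T X) + X \<in> L" by (intro cl J X)
    moreover have "(1/4) *\<^sub>R ?T (?T (?T (?T X))) + (5/4) *\<^sub>R ?T (?T X) + X = ?X0"
      by (simp add: X_eq i field_simps)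
    ultimately have X0: "?X0 \<in> L" by simp
    \<comment> \<open>Every element of L is singular, whereas the determinant of this component
      vanishes only for a + e = 0.\<close>
    have e: "e = - a"
    proof (rule ccontr)
      assume "e \<noteq> - a"
      then have "a + e \<noteq> 0" by simp
      then have "(a + e) * ((a + e)\<^sup>2 + (d - b)\<^sup>2) \<noteq> 0" by (simp add: add_nonneg_eq_0_iff)
      moreover have "det ?X0 = - (a + e) * ((a + e)\<^sup>2 + (d - b)\<^sup>2) / 4"
        by (simp add: field_simps power2_eq_square)
      moreover have "det ?X0 = 0" using neg(1)[OF X0] \<open>a + e \<noteq> 0\<close> by auto
      ultimately show False by simp
    qed
    let ?X2 = "mat3 ((a-e)/2) ((b+d)/2) 0 ((b+d)/2) (- (a-e)/2) 0 0 0 0"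
    \<comment> \<open>Component for eigenvalue -4: (t^2 + t)/12 equals 1 at -4 and vanishes at 0 and
      -1. It is symmetric, so the trace of its square cannot be negative.\<close>
    have "(1/12) *\<^sub>R (?T (?T (?T (?T X))) + ?T (?T X)) \<in> L" by (intro cl J X)
    moreover have "(1/12) *\<^sub>R (?T (?T (?T (?T X))) + ?T (?T X)) = ?X2"
      by (simp add: X_eq i field_simps)
    ultimately have X2: "?X2 \<in> L" by simp
    have "trace (?X2 ** ?X2) = ((a-e)\<^sup>2 + (b+d)\<^sup>2) / 2" by (simp add: field_simps power2_eq_square)
    then have "\<not> trace (?X2 ** ?X2) < 0" by (simp add: not_less)
    then have "?X2 = 0" using neg(2)[OF X2] by blast
    then have "(a - e) / 2 = 0" "(b + d) / 2 = 0" unfolding mat3_eq_0_iff by blast+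
    then have "a = 0" and "b + d = 0" using e by simp_all
    then have b: "b = - d" by simp
    have "X - d *\<^sub>R mat3 0 (-1) 0 1 0 0 0 0 0 \<in> L" by (intro cl J X)
    then show ?thesis using e \<open>a = 0\<close> b i by (simp add: X_eq)
  qed
  have neg1: "v * x + w * y < 0" if "mat3 0 0 v 0 0 w x y 0 \<in> L" "\<not> (v = 0 \<and> w = 0 \<and> x = 0 \<and> y = 0)" for v w x y
    using neg(2)[OF that(1)] that(2) by (simp add: algebra_simps)
  obtain X j where X: "X \<in> L" "j \<noteq> 3" "X $ j $ 3 \<noteq> 0" using irreducible_column[OF irr] by metis
  define v where "v = X $ 1 $ 3"
  define w where "w = X $ 2 $ 3"
  have "v \<noteq> 0 \<or> w \<noteq> 0" using X exhaust_3[of j] by (auto simp: v_def w_def)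
  define n where "n = v\<^sup>2 + w\<^sup>2"
  have n: "n \<noteq> 0" using \<open>v \<noteq> 0 \<or> w \<noteq> 0\<close> by (auto simp: n_def add_nonneg_eq_0_iff)
  define x where "x = X $ 3 $ 1"
  define y where "y = X $ 3 $ 2"
  have X1: "mat3 0 0 v 0 0 w x y 0 \<in> L" using shape[OF X(1)] by (simp add: v_def w_def x_def y_def)
  define c where "c = (v * x + w * y) / n"
  define d where "d = (v * y - w * x) / n"
  \<comment> \<open>\<open>ad J\<close> turns the vector (v, w) by a right angle, so this
    combination moves it to (1, 0).\<close>
  have "(1 / n) *\<^sub>R (v *\<^sub>R mat3 0 0 v 0 0 w x y 0 - w *\<^sub>R ?T (mat3 0 0 v 0 0 w x y 0)) \<in> L"
    by (intro cl J X1)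
  moreover have "(1 / n) *\<^sub>R (v *\<^sub>R mat3 0 0 v 0 0 w x y 0 - w *\<^sub>R ?T (mat3 0 0 v 0 0 w x y 0)) =
      mat3 0 0 ((v * v + w * w) / n) 0 0 0 c d 0"
    by (simp add: c_def d_def add_divide_distrib diff_divide_distrib mult.commute)
  moreover have "(v * v + w * w) / n = 1" using n by (simp add: n_def power2_eq_square)
  ultimately have Z: "mat3 0 0 1 0 0 0 c d 0 \<in> L" by simp
  have Z': "mat3 0 0 0 0 0 1 (- d) c 0 \<in> L" using cl(4)[OF J Z] by simp
  \<comment> \<open>The (1,1) entry of the bracket is -d, and elements of L have zero
    diagonal.\<close>
  have "d = 0" using shape[OF cl(4)[OF Z Z']] by simp
  have c: "c < 0" using neg1[OF Z] by simp
  have L: "L = {mat3 0 (- a) v a 0 w (c * v) (c * w) 0 | a v w. True}"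
  proof (intro equalityI subsetI)
    fix Y assume Y: "Y \<in> L"
    define v where "v = Y $ 1 $ 3"
    define w where "w = Y $ 2 $ 3"
    have Y1: "mat3 0 0 v 0 0 w (Y$3$1) (Y$3$2) 0 \<in> L" using shape[OF Y] by (simp add: v_def w_def)
    have "mat3 0 0 v 0 0 w (Y$3$1) (Y$3$2) 0 - v *\<^sub>R mat3 0 0 1 0 0 0 c d 0 - w *\<^sub>R mat3 0 0 0 0 0 1 (- d) c 0 \<in> L"
      by (intro cl Y1 Z Z')
    then have "mat3 0 0 0 0 0 0 (Y$3$1 - c * v) (Y$3$2 - c * w) 0 \<in> L"
      by (simp add: \<open>d = 0\<close> mult.commute)
    from neg1[OF this] have "Y$3$1 = c * v" "Y$3$2 = c * w" by auto
    then have "Y = mat3 0 (- Y$2$1) v (Y$2$1) 0 w (c * v) (c * w) 0"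
      using shape[OF Y] by (subst mat3_eta[symmetric]) (simp add: v_def w_def)
    then show "Y \<in> {mat3 0 (- a) v a 0 w (c * v) (c * w) 0 | a v w. True}" by blast
  next
    fix Y assume "Y \<in> {mat3 0 (- a) v a 0 w (c * v) (c * w) 0 | a v w. True}"
    then obtain a v w where Y: "Y = mat3 0 (- a) v a 0 w (c * v) (c * w) 0" by blast
    have "a *\<^sub>R mat3 0 (-1) 0 1 0 0 0 0 0 + v *\<^sub>R mat3 0 0 1 0 0 0 c d 0 + w *\<^sub>R mat3 0 0 0 0 0 1 (- d) c 0 \<in> L"
      by (intro cl J Z Z')
    then show "Y \<in> L" by (simp add: Y \<open>d = 0\<close> mult.commute)
  qed
  show thesis using that[OF c L] .
qed

lemma conjugate_u_3_18_if_nilpotent_free: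
  assumes irr: "irreducible_sl3_subalgebra L" and nil: "nilpotent_free L"
  shows "SL3_conjugate L u_3_18"
proof -
  obtain X :: "real^3^3" and i where "X \<in> L" "i \<noteq> 1" "X $ i $ 1 \<noteq> 0"
    using irreducible_column[OF irr] by metis
  moreover from this have "X \<noteq> 0" by auto
  ultimately obtain L1 where L1: "SL3_conjugate L L1" "mat3 0 (-1) 0 1 0 0 0 0 0 \<in> L1"
    using nilpotent_free_rotation(3)[OF irr nil, of X] by blast
  obtain c where c: "c < 0" and L1_eq: "L1 = {mat3 0 (- a) v a 0 w (c * v) (c * w) 0 | a v w. True}"
    using rotation_algebra[OF irreducible_sl3_subalgebra_conj[OF irr L1(1)]
        nilpotent_free_conj[OF nil L1(1)] L1(2)] .
  define m where "m = sqrt 8"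
  define n where "n = sqrt (- c)"
  have m: "m \<noteq> 0" "m * m = 8" by (simp_all add: m_def)
  have n: "n \<noteq> 0" "c = - (n * n)" using c by (simp_all add: n_def)
  \<comment> \<open>Substituting P into x^2 + y^2 - z^2/c gives x^2 + 8 y^2 + z^2, the form
    belonging to \<open>u_3_18\<close>.\<close>
  define P where "P = mat3 1 0 0 0 m 0 0 0 n"
  have "det P \<noteq> 0" using m n by (simp add: P_def)
  then obtain L2 where L2: "SL3_conjugate L1 L2" "\<And>X X'. X \<in> L1 \<Longrightarrow> X ** P = P ** X' \<Longrightarrow> X' \<in> L2"
    "\<And>X'. X' \<in> L2 \<Longrightarrow> \<exists>X\<in>L1. X ** P = P ** X'"
    by (rule change_basis) blast
  have "L2 = u_3_18"
  proof (intro equalityI subsetI)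
    fix X' assume "X' \<in> L2"
    then obtain a v w where eq: "mat3 0 (- a) v a 0 w (c * v) (c * w) 0 ** P = P ** X'"
      using L2(3) L1_eq by blast
    obtain x11 x12 x13 x21 x22 x23 x31 x32 x33 where
      X': "X' = mat3 x11 x12 x13 x21 x22 x23 x31 x32 x33" by (rule mat3_cases)
    have "x11 = 0" "x22 = 0" "x33 = 0" "x13 = v * n" "x12 = - (m * (m * x21))" "m * x23 = w * n"
      "n * x31 = - (n * n) * v" "n * x32 = - (n * n) * w * m"
      using eq m(1) n(1) by (auto simp: P_def X' n(2) mult_ac)
    then have "x11 = 0" "x22 = 0" "x33 = 0" "x12 = 8 * (- x21)" "x31 = - x13" "x32 = 8 * (- x23)"
      using m n by algebra+
    then show "X' \<in> u_3_18" unfolding u_3_18_eq X' by force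
  next
    fix X' assume "X' \<in> u_3_18"
    then obtain a b d where X': "X' = mat3 0 (8*a) b (- a) 0 (- d) (- b) (8*d) 0"
      unfolding u_3_18_eq by blast
    show "X' \<in> L2"
    proof (rule L2(2))
      show "mat3 0 (- (- a * m)) (b / n) (- a * m) 0 (- d * m / n) (c * (b / n)) (c * (- d * m / n)) 0 \<in> L1"
        unfolding L1_eq by blast
      show "mat3 0 (- (- a * m)) (b / n) (- a * m) 0 (- d * m / n) (c * (b / n)) (c * (- d * m / n)) 0 ** P =
          P ** X'"
        using m n by (simp add: P_def X')
    qed
  qed
  then show ?thesis using SL3_conjugate_trans[OF L1(1) L2(1)] by simp
qed

section \<open>Semisimple subalgebras\<close>

lemma irreducible_classification:
  assumes irr: "irreducible_sl3_subalgebra L" "L \<noteq> sl3"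
  shows "SL3_conjugate L u_3_17 \<or> SL3_conjugate L u_3_18"
proof (cases "nilpotent_free L")
  case True
  then show ?thesis using conjugate_u_3_18_if_nilpotent_free[OF irr(1)] by blast
next
  case False
  then obtain X where X: "X \<in> L" "trace (X ** X) = 0" "det X = 0" "X \<noteq> 0"
    unfolding nilpotent_free_def by blast
  have "X ** X ** X = 0"
    using X by (simp add: cube_traceless[OF irreducible_sl3_subalgebraD(2)[OF irr(1) X(1)]])
  then show ?thesis using conjugate_u_3_17_if_nilpotent[OF irr X(1,4)] by blast
qed

section \<open>Transport of semisimplicity, and small solvable algebras\<close>

lemma derived_series_image:
  assumes "linear f" "\<And>A B. f (lie_bracket A B) = lie_bracket (f A) (f B)"
  shows "derived_series (f ` L) k = f ` derived_series L k"
proof (induction k)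
  case (Suc k)
  have "{lie_bracket A B | A B. A \<in> f ` derived_series L k \<and> B \<in> f ` derived_series L k} =
      {f (lie_bracket A B) | A B. A \<in> derived_series L k \<and> B \<in> derived_series L k}"
    by (auto simp: assms(2))
  also have "\<dots> = f ` {lie_bracket A B | A B. A \<in> derived_series L k \<and> B \<in> derived_series L k}"
    by blast
  finally have "{lie_bracket A B | A B. A \<in> f ` derived_series L k \<and> B \<in> f ` derived_series L k} = \<dots>" .
  then show ?case using Suc by (simp add: linear_span_image[OF assms(1)])
qed simp

text \<open>A solvable ideal of the image pulls back to an ideal of L, solvable because f is
  injective and carries derived series to derived series.\<close>

lemma lie_semisimple_image:
  assumes L: "lie_semisimple L" and f: "linear f" "inj f"
    and hom: "\<And>A B. f (lie_bracket A B) = lie_bracket (f A) (f B)"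
  shows "lie_semisimple (f ` L)"
  unfolding lie_semisimple_def
proof (intro conjI allI impI)
  have alg: "lie_subalgebra L" using L by (simp add: lie_semisimple_def)
  show "lie_subalgebra (f ` L)" by (rule lie_subalgebra_image[OF alg f(1) hom])
  fix I assume I: "lie_ideal I (f ` L) \<and> lie_solvable I"
  define J where "J = {X \<in> L. f X \<in> I}"
  have fJ: "f ` J = I" using I by (auto simp: J_def lie_ideal_def)
  have "J = L \<inter> f -` I" by (auto simp: J_def)
  then have "subspace J"
    using alg I f(1) by (simp add: subspace_inter linear_subspace_vimage lie_subalgebra_def lie_ideal_def)
  then have "lie_ideal J L"
    using I alg by (auto simp: J_def lie_ideal_def lie_subalgebra_def hom)
  moreover have "lie_solvable J"
  proof -
    obtain k where "derived_series (f ` J) k = {0}" using I fJ by (auto simp: lie_solvable_def)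
    then have "f ` derived_series J k = f ` {0}"
      unfolding derived_series_image[OF f(1) hom] by (simp add: linear_0[OF f(1)])
    then have "derived_series J k = {0}" by (rule iffD1[OF inj_image_eq_iff[OF f(2)]])
    then show ?thesis unfolding lie_solvable_def by blast
  qed
  ultimately have "J = {0}" using L unfolding lie_semisimple_def by blast
  then have "I = {f 0}" using fJ by simp
  then show "I = {0}" by (simp add: linear_0[OF f(1)])
qed

lemma lie_semisimple_conj:
  assumes "lie_semisimple L" "SL3_conjugate L L'"
  shows "lie_semisimple L'"
proof -
  obtain g h where gh: "g ** h = mat 1" "h ** g = mat 1" and L': "L' = conjm g h ` L"
    using assms(2) by (auto simp: SL3_conjugate_iff)
  have "inj (conjm g h)" using conjm_inverse[OF gh(2)] by (metis injI)
  then show ?thesis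
    unfolding L' using gh assms(1) by (intro lie_semisimple_image linear_conjm conjm_lie_bracket)
qed

lemma abelian_lie_solvable:
  assumes "0 \<in> I" "\<And>A B. A \<in> I \<Longrightarrow> B \<in> I \<Longrightarrow> lie_bracket A B = 0"
  shows "lie_solvable I"
proof -
  have "{lie_bracket A B | A B. A \<in> I \<and> B \<in> I} = {0}" using assms by fastforce
  then have "derived_series I (Suc 0) = {0}" by (simp add: span_insert_0[of "{}", simplified])
  then show ?thesis unfolding lie_solvable_def by blast
qed

text \<open>All brackets are multiples of [a,b], so the first derived term is at most
  one-dimensional and the second is zero.\<close>

lemma span_two_lie_solvable: "lie_solvable (span {a, b})"
proof -
  have mult: "\<exists>t. lie_bracket A B = t *\<^sub>R lie_bracket a b" if AB: "A \<in> span {a, b}" "B \<in> span {a, b}" for A B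
  proof -
    obtain x y x' y' where A: "A = x *\<^sub>R a + y *\<^sub>R b" and B: "B = x' *\<^sub>R a + y' *\<^sub>R b"
      using AB by (auto simp: span_breakdown_eq span_singleton algebra_simps)
    have "lie_bracket A B = (x * y' - y * x') *\<^sub>R lie_bracket a b"
      by (simp add: A B lie_bracket_linear_simps lie_bracket_self lie_bracket_swap[of b a] algebra_simps)
    then show ?thesis by blast
  qed
  define D where "D = derived_series (span {a, b}) 1"
  have "lie_bracket A B \<in> span {lie_bracket a b}" if "A \<in> span {a, b}" "B \<in> span {a, b}" for A B
    using mult[OF that] by (auto simp: span_singleton)
  then have "{lie_bracket A B | A B. A \<in> span {a, b} \<and> B \<in> span {a, b}} \<subseteq> span {lie_bracket a b}"
    by blast
  then have "D \<subseteq> span {lie_bracket a b}" by (simp add: D_def span_minimal)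
  then have D_multiple: "\<exists>t. A = t *\<^sub>R lie_bracket a b" if "A \<in> D" for A
    using that by (auto simp: span_singleton)
  then have "lie_bracket A B = 0" if AB: "A \<in> D" "B \<in> D" for A B
  proof -
    obtain s t where "A = s *\<^sub>R lie_bracket a b" "B = t *\<^sub>R lie_bracket a b"
      using D_multiple AB by blast
    then show ?thesis by (simp add: lie_bracket_linear_simps lie_bracket_self)
  qed
  moreover have "0 \<in> D" unfolding D_def by (simp add: span_0)
  ultimately have "{lie_bracket A B | A B. A \<in> D \<and> B \<in> D} = {0}" by fastforce
  then have "derived_series (span {a, b}) (Suc 1) = {0}"
    unfolding derived_series.simps(2) D_def by (simp add: span_insert_0[of "{}", simplified])
  then show ?thesis unfolding lie_solvable_def by blast
qed

lemma dim_le_2_span_two: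
  fixes S :: "'a::euclidean_space set"
  assumes "subspace S" "dim S \<le> 2"
  obtains a b where "S = span {a, b}"
proof -
  obtain B where B: "B \<subseteq> S" "independent B" "S \<subseteq> span B" "card B = dim S"
    using basis_exists by blast
  have S: "S = span B" using B assms(1) by (metis span_subspace)
  have "finite B" using B(2) by (simp add: finiteI_independent)
  consider "card B = 0" | "card B = 1" | "card B = 2" using B(4) assms(2) by linarith
  then show thesis
  proof cases
    case 1
    then have "S = span {0, 0}" using S \<open>finite B\<close> by (simp add: span_insert_0)
    then show thesis using that by blast
  next
    case 2
    then obtain a where "B = {a}" by (rule card_1_singletonE)
    then show thesis using that[of a a] S by simp
  next
    case 3
    then show thesis using that S by (auto simp: card_2_iff)
  qed
qed

section \<open>Reducible semisimple subalgebras\<close>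

lemma lie_semisimpleD:
  assumes "lie_semisimple L"
  shows "lie_subalgebra L" "lie_ideal I L \<Longrightarrow> lie_solvable I \<Longrightarrow> I = {0}"
  using assms unfolding lie_semisimple_def by blast+

text \<open>The invariant line is spanned by e2, so the complementary block sits in rows and columns
  1 and 3, as in \<open>u_3_16\<close>.\<close>

lemma semisimple_block:
  assumes ss: "lie_semisimple L" and tr: "L \<subseteq> sl3" and nz: "L \<noteq> {0}"
    and blk: "\<And>A. A \<in> L \<Longrightarrow> A $ 1 $ 2 = 0 \<and> A $ 3 $ 2 = 0"
  shows "SL3_conjugate L u_3_16"
proof -
  note L = lie_semisimpleD(1)[OF ss]
  note cl = lie_subalgebraD[OF L]
  have sub: "subspace L" using L by (simp add: lie_subalgebra_def)
  have shape: "\<exists>a b c d x y. A = mat3 a 0 b x (- a - d) y c 0 d" if A: "A \<in> L" for A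
  proof -
    obtain a b c d e f g h i where A_eq: "A = mat3 a b c d e f g h i" by (rule mat3_cases)
    have "e = - a - i" using A tr by (auto simp: A_eq)
    then show ?thesis using blk[OF A] by (auto simp: A_eq)
  qed
  have zero: "A = 0" if "A \<in> L" "A$1$1 = 0" "A$1$3 = 0" "A$3$1 = 0" "A$3$3 = 0" for A
  proof -
    \<comment> \<open>With zero corner block the trace kills the (2,2) entry as well; only (2,1) and
      (2,3) remain, and such matrices commute.\<close>
    define K where "K = {A \<in> L. A$1$1 = 0 \<and> A$1$3 = 0 \<and> A$3$1 = 0 \<and> A$3$3 = 0}"
    have "subspace K" using sub unfolding subspace_def K_def by simp
    moreover have "lie_bracket A B \<in> K" if "A \<in> L" "B \<in> K" for A B
      using shape[of A] shape[of B] that cl(4)[of A B] unfolding K_def by auto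
    ultimately have "lie_ideal K L" unfolding lie_ideal_def K_def by auto
    moreover have "lie_solvable K"
    proof (rule abelian_lie_solvable)
      show "0 \<in> K" using \<open>subspace K\<close> subspace_0 by blast
      show "lie_bracket A B = 0" if "A \<in> K" "B \<in> K" for A B
        using shape[of A] shape[of B] that unfolding K_def by auto
    qed
    ultimately have "K = {0}" using lie_semisimpleD(2)[OF ss] by blast
    then show ?thesis using that unfolding K_def by blast
  qed
  have scalar: "A = 0" if "A \<in> L" "A$1$1 = A$3$3" "A$1$3 = 0" "A$3$1 = 0" for A
  proof -
    define K where "K = {A \<in> L. A$1$1 = A$3$3 \<and> A$1$3 = 0 \<and> A$3$1 = 0}"
    have "subspace K" using sub unfolding subspace_def K_def by simp
    \<comment> \<open>A bracket with such a B has zero corner block, so \<open>zero\<close> makes it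
      vanish.\<close>
    have central: "lie_bracket A B = 0" if "A \<in> L" "B \<in> K" for A B
      using shape[of A] shape[of B] that cl(4)[of A B] unfolding K_def by (intro zero) auto
    have "0 \<in> K" using \<open>subspace K\<close> subspace_0 by blast
    then have "lie_ideal K L" using \<open>subspace K\<close> central unfolding lie_ideal_def by (auto simp: K_def)
    moreover have "lie_solvable K"
      using \<open>0 \<in> K\<close> central by (intro abelian_lie_solvable) (auto simp: K_def)
    ultimately have "K = {0}" using lie_semisimpleD(2)[OF ss] by blast
    then show ?thesis using that unfolding K_def by blast
  qed
  define I where "I = {A \<in> L. A $ 2 $ 2 = 0}"
  have subI: "subspace I" using sub unfolding subspace_def I_def by simp
  have brI: "lie_bracket A B \<in> I" if "A \<in> L" "B \<in> L" for A B
    using shape[of A] shape[of B] that cl(4)[of A B] unfolding I_def by auto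
  then have ideal: "lie_ideal I L" using subI unfolding lie_ideal_def by (auto simp: I_def)
  \<comment> \<open>The ideal I contains all brackets. If its dimension were at most two it would be
    solvable, hence zero, and L would be abelian.\<close>
  have "\<not> dim I \<le> 2"
  proof
    assume "dim I \<le> 2"
    then obtain a b where "I = span {a, b}" using dim_le_2_span_two[OF subI] by blast
    then have "I = {0}" using lie_semisimpleD(2)[OF ss ideal] span_two_lie_solvable by blast
    then have "lie_solvable L" using brI sub subspace_0 by (intro abelian_lie_solvable) auto
    moreover have "lie_ideal L L" using sub cl(4) by (auto simp: lie_ideal_def)
    ultimately show False using lie_semisimpleD(2)[OF ss] nz by blast
  qed
  define \<phi> :: "real^3^3 \<Rightarrow> real^3" where "\<phi> = (\<lambda>A. vector [A$1$1, A$1$3, A$3$1])"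
  have lin: "linear \<phi>" by (rule linearI) (simp_all add: \<phi>_def vec_eq_iff forall_3)
  have "A = 0" if "A \<in> I" "\<phi> A = 0" for A
  proof -
    have "A \<in> L" "A$1$1 = 0" "A$1$3 = 0" "A$3$1 = 0" "A$2$2 = 0"
      using that by (simp_all add: I_def \<phi>_def vec_eq_iff forall_3)
    then show ?thesis using shape[of A] by (intro zero) auto
  qed
  then have "inj_on \<phi> I" using linear_injective_on_subspace_0[OF lin subI] by blast
  then have "dim (\<phi> ` I) = dim I" using lin subI by (simp add: dim_image_eq span_eq_iff[THEN iffD2])
  then have "dim (UNIV :: (real^3) set) \<le> dim (\<phi> ` I)" using \<open>\<not> dim I \<le> 2\<close> by simp
  then have onto: "\<phi> ` I = UNIV"
    using linear_subspace_image[OF lin subI] by (intro subspace_dim_equal) auto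
  have lift: "\<exists>r s. mat3 a 0 b r 0 s c 0 (- a) \<in> L" for a b c
  proof -
    obtain A where A: "A \<in> I" "\<phi> A = vector [a, b, c]" using onto by (metis UNIV_I imageE)
    then have "A \<in> L" "A$2$2 = 0" "A$1$1 = a" "A$1$3 = b" "A$3$1 = c"
      by (simp_all add: I_def \<phi>_def vec_eq_iff forall_3)
    moreover from this have "A = mat3 a 0 b (A$2$1) 0 (A$2$3) c 0 (- a)" using shape[of A] by auto
    ultimately show ?thesis by metis
  qed
  obtain h1 h2 where H: "mat3 1 0 0 h1 0 h2 0 0 (- 1) \<in> L" using lift[of 1 0 0] by auto
  obtain x1 x2 where X: "mat3 0 0 1 x1 0 x2 0 0 0 \<in> L" using lift[of 0 1 0] by auto
  obtain y1 y2 where Y: "mat3 0 0 0 y1 0 y2 1 0 0 \<in> L" using lift[of 0 0 1] by auto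
  \<comment> \<open>The sl2 relation holds on the corner block, so by \<open>zero\<close> it holds
    in L; this determines the second row of the lift. The same is done for Y.\<close>
  have "lie_bracket (mat3 1 0 0 h1 0 h2 0 0 (- 1)) (mat3 0 0 1 x1 0 x2 0 0 0) - 2 *\<^sub>R mat3 0 0 1 x1 0 x2 0 0 0 \<in> L"
    by (intro cl H X)
  from zero[OF this] have x: "x1 = 0" "x2 = h1" by simp_all
  have "lie_bracket (mat3 1 0 0 h1 0 h2 0 0 (- 1)) (mat3 0 0 0 y1 0 y2 1 0 0) + 2 *\<^sub>R mat3 0 0 0 y1 0 y2 1 0 0 \<in> L"
    by (intro cl H Y)
  from zero[OF this] have y: "y1 = - h2" "y2 = 0" by simp_all
  have comb: "mat3 a 0 b (a * h1 - c * h2) 0 (a * h2 + b * h1) c 0 (- a) \<in> L" for a b c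
  proof -
    have "a *\<^sub>R mat3 1 0 0 h1 0 h2 0 0 (- 1) + b *\<^sub>R mat3 0 0 1 x1 0 x2 0 0 0 + c *\<^sub>R mat3 0 0 0 y1 0 y2 1 0 0 \<in> L"
      by (intro cl H X Y)
    then show ?thesis by (simp add: x y)
  qed
  have L_comb: "\<exists>a b c. A = mat3 a 0 b (a * h1 - c * h2) 0 (a * h2 + b * h1) c 0 (- a)" if A: "A \<in> L" for A
  proof -
    obtain a b c d r s where A_eq: "A = mat3 a 0 b r (- a - d) s c 0 d" using shape[OF A] by blast
    \<comment> \<open>The lift with this value shares the traceless part of the corner block with A,
      so the difference has scalar block and vanishes by \<open>scalar\<close>.\<close>
    let ?a = "(a - d) / 2"
    let ?C = "mat3 ?a 0 b (?a * h1 - c * h2) 0 (?a * h2 + b * h1) c 0 (- ?a)"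
    have "A - ?C \<in> L" by (intro cl A comb)
    from scalar[OF this] have "A - ?C = 0" by (simp add: A_eq field_simps)
    then show ?thesis by (metis eq_iff_diff_eq_0)
  qed
  \<comment> \<open>The columns are eigenvectors of the lift of diag(1,-1), for 1, 0, -1; their span
    of the outer two is the invariant complement.\<close>
  define P where "P = mat3 1 0 0 h1 1 (- h2) 0 0 1"
  have "det P \<noteq> 0" by (simp add: P_def)
  then obtain L' where L': "SL3_conjugate L L'" "\<And>X X'. X \<in> L \<Longrightarrow> X ** P = P ** X' \<Longrightarrow> X' \<in> L'"
    "\<And>X'. X' \<in> L' \<Longrightarrow> \<exists>X\<in>L. X ** P = P ** X'"
    by (rule change_basis) blast
  have "L' = u_3_16"
  proof (intro equalityI subsetI)
    fix A' assume "A' \<in> L'"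
    then obtain a b c where eq: "mat3 a 0 b (a * h1 - c * h2) 0 (a * h2 + b * h1) c 0 (- a) ** P = P ** A'"
      using L'(3) L_comb by metis
    obtain a11 a12 a13 a21 a22 a23 a31 a32 a33 where
      A': "A' = mat3 a11 a12 a13 a21 a22 a23 a31 a32 a33" by (rule mat3_cases)
    have "a12 = 0" "a21 = 0" "a22 = 0" "a23 = 0" "a32 = 0" "a33 = - a11"
      using eq by (auto simp: P_def A' algebra_simps)
    then show "A' \<in> u_3_16" by (auto simp: u_3_16_eq A')
  next
    fix A' assume "A' \<in> u_3_16"
    then obtain a b c where A': "A' = mat3 a 0 b 0 0 0 c 0 (- a)" by (auto simp: u_3_16_eq)
    show "A' \<in> L'" by (rule L'(2)[OF comb[of a b c]]) (simp add: P_def A' algebra_simps)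
  qed
  then show ?thesis using L'(1) by simp
qed

lemma semisimple_reducible_line:
  assumes ss: "lie_semisimple L" and tr: "L \<subseteq> sl3" and nz: "L \<noteq> {0}" and red: "\<not> irreducible_on L"
  shows "SL3_conjugate L u_3_16"
proof -
  obtain v where v: "v \<noteq> 0" "\<And>A. A \<in> L \<Longrightarrow> \<exists>c. A *v v = c *\<^sub>R v"
    using red unfolding irreducible_on_def by blast
  obtain a b where "det (cols a b v) \<noteq> 0" using extend_to_basis[OF v(1)] .
  \<comment> \<open>Exchanging two columns puts the invariant line in the middle and only flips the
    sign of the determinant.\<close>
  then have P: "det (cols a v b) \<noteq> 0" by (simp add: cols_def algebra_simps)
  then obtain g where g: "g ** cols a v b = mat 1"
    by (auto simp: invertible_def simp flip: invertible_det_nz)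
  have inj: "z = 0" if "cols a v b *v z = 0" for z
    by (metis that g matrix_vector_mul_assoc matrix_vector_mul_lid matrix_vector_mult_0_right)
  obtain L' where L': "SL3_conjugate L L'" "\<And>X'. X' \<in> L' \<Longrightarrow> \<exists>X\<in>L. X ** cols a v b = cols a v b ** X'"
    using change_basis[OF P] by metis
  have "SL3_conjugate L' u_3_16"
  proof (rule semisimple_block)
    show "lie_semisimple L'" using lie_semisimple_conj[OF ss L'(1)] .
    obtain g h where gh: "g ** h = mat 1" "h ** g = mat 1" and eq: "L' = conjm g h ` L"
      using L'(1) by (auto simp: SL3_conjugate_iff)
    show "L' \<subseteq> sl3" using tr by (auto simp: eq sl3_def trace_conjm[OF gh(2)])
    show "L' \<noteq> {0}"
    proof
      assume "L' = {0}"
      then have "conjm h g ` L' = {0}" by (simp add: conjm_def)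
      then show False using nz by (simp add: eq image_image conjm_inverse[OF gh(2)])
    qed
    fix X' assume "X' \<in> L'"
    then obtain X where X: "X \<in> L" "X ** cols a v b = cols a v b ** X'" using L'(2) by blast
    obtain c where c: "X *v v = c *\<^sub>R v" using v(2) X(1) by blast
    obtain x11 x12 x13 x21 x22 x23 x31 x32 x33 where
      X': "X' = mat3 x11 x12 x13 x21 x22 x23 x31 x32 x33" by (rule mat3_cases)
    have "cols a v b *v vector [x12, x22 - c, x32] = 0"
      using X(2) c by (simp add: X' mult_cols cols_mult_mat3 cols_mult_vec)
        (simp add: cols_def vec_eq_iff forall_3 algebra_simps)
    from inj[OF this] show "X' $ 1 $ 2 = 0 \<and> X' $ 3 $ 2 = 0"
      by (simp add: X' vec_eq_iff forall_3)
  qed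
  then show ?thesis using L'(1) SL3_conjugate_trans by blast
qed

lemma lie_bracket_neg_transpose:
  "- transpose (lie_bracket A B) = lie_bracket (- transpose A) (- transpose B)"
  for A B :: "real^'n^'n"
proof -
  have "(- C) ** (- D) = C ** D" for C D :: "real^'n^'n"
    using matrix_scaleR_left[of "-1" C "- D"] matrix_scaleR_right[of C "-1" D] by simp
  then show ?thesis by (simp add: lie_bracket_def transpose_diff matrix_transpose_mul)
qed

text \<open>\<open>u_3_16\<close> is stable under A -> -A^T, so a conjugacy found for the image of L
  under this automorphism transposes back to one for L.\<close>

lemma semisimple_reducible:
  assumes ss: "lie_semisimple L" and tr: "L \<subseteq> sl3" and nz: "L \<noteq> {0}"
    and red: "\<not> irreducible_sl3_subalgebra L"
  shows "SL3_conjugate L u_3_16"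
proof (cases "irreducible_on L")
  case False
  then show ?thesis by (rule semisimple_reducible_line[OF ss tr nz])
next
  case True
  let ?t = "\<lambda>A :: real^3^3. - transpose A"
  have tt: "?t (?t A) = A" for A by (simp add: vec_eq_iff transpose_def)
  have lin: "linear ?t" by (rule linearI) (simp_all add: vec_eq_iff transpose_def)
  have inj: "inj ?t" using tt by (metis injI)
  have red': "\<not> irreducible_on (transpose ` L)"
    using red True tr lie_semisimpleD(1)[OF ss] by (simp add: irreducible_sl3_subalgebra_def)
  have "SL3_conjugate (?t ` L) u_3_16"
  proof (rule semisimple_reducible_line)
    show "lie_semisimple (?t ` L)"
      by (rule lie_semisimple_image[OF ss lin inj lie_bracket_neg_transpose])
    show "?t ` L \<subseteq> sl3" using tr by (auto simp: sl3_def trace_def transpose_def sum_negf)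
    show "?t ` L \<noteq> {0}"
    proof
      assume "?t ` L = {0}"
      then have "?t ` ?t ` L = {0}" by (simp add: vec_eq_iff transpose_def)
      then show False using nz by (simp add: image_image tt)
    qed
    obtain v where v: "v \<noteq> 0" "\<And>A. A \<in> L \<Longrightarrow> \<exists>c. transpose A *v v = c *\<^sub>R v"
      using red' unfolding irreducible_on_def by blast
    have "\<exists>c. ?t A *v v = c *\<^sub>R v" if A: "A \<in> L" for A
    proof -
      obtain c where "transpose A *v v = c *\<^sub>R v" using v(2)[OF A] by blast
      moreover have "?t A *v v = - (transpose A *v v)"
        by (simp add: vec_eq_iff matrix_vector_mult_def sum_negf)
      ultimately have "?t A *v v = (- c) *\<^sub>R v" by simp
      then show ?thesis by blast
    qed
    then show "\<not> irreducible_on (?t ` L)" using v(1) unfolding irreducible_on_def by fastforce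
  qed
  then obtain g h where gh: "g ** h = mat 1" "h ** g = mat 1" and eq: "u_3_16 = conjm g h ` ?t ` L"
    by (auto simp: SL3_conjugate_iff)
  have "?t A \<in> u_3_16" if "A \<in> u_3_16" for A using that by (auto simp: u_3_16_eq)
  then have "u_3_16 = ?t ` u_3_16" using tt by (metis (no_types, lifting) image_eqI subsetI subset_antisym image_subsetI)
  also have "\<dots> = conjm (transpose h) (transpose g) ` L"
  proof -
    have "transpose (- A) = - transpose A" for A :: "real^3^3" by (simp add: vec_eq_iff transpose_def)
    then have "?t (conjm g h (?t A)) = conjm (transpose h) (transpose g) A" for A
      by (simp add: linear_neg[OF linear_conjm] transpose_conjm)
    then show ?thesis unfolding eq by (simp only: image_image)
  qed
  finally have "u_3_16 = conjm (transpose h) (transpose g) ` L" .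
  moreover have "transpose h ** transpose g = mat 1" "transpose g ** transpose h = mat 1"
    using gh by (simp_all flip: matrix_transpose_mul)
  ultimately show ?thesis unfolding SL3_conjugate_iff by blast
qed

section \<open>The three subalgebras\<close>

lemma subspace_scale_cancel:
  assumes "subspace S" "k *\<^sub>R x \<in> S" "k \<noteq> 0"
  shows "x \<in> S"
  using subspace_scale[OF assms(1,2), of "1 / k"] assms(3) by simp

text \<open>These are the cross product relations up to nonzero scalars. The span is perfect, hence
  not solvable, and any nonzero ideal contains one of A, B, C and therefore all.\<close>

lemma cyclic_triple_lie_semisimple:
  fixes A B C :: "real^'n^'n"
  assumes br: "lie_bracket A B = c *\<^sub>R C" "lie_bracket B C = a *\<^sub>R A" "lie_bracket C A = b *\<^sub>R B"
    and nz: "a \<noteq> 0" "b \<noteq> 0" "c \<noteq> 0"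
  shows "lie_semisimple (span {A, B, C})"
proof -
  let ?L = "span {A, B, C}"
  have br': "lie_bracket B A = - (c *\<^sub>R C)" "lie_bracket C B = - (a *\<^sub>R A)" "lie_bracket A C = - (b *\<^sub>R B)"
    by (simp_all add: lie_bracket_swap[of B A] lie_bracket_swap[of C B] lie_bracket_swap[of A C] br)
  have diff: "lie_bracket X (Y - Z) = lie_bracket X Y - lie_bracket X Z" for X Y Z :: "real^'n^'n"
    by (simp add: lie_bracket_def matrix_diff_left matrix_diff_right)
  note brs = br br' diff lie_bracket_self lie_bracket_linear_simps
  have alg: "lie_subalgebra ?L"
    unfolding lie_subalgebra_def
  proof (intro conjI ballI subspace_span)
    fix X Y assume "X \<in> ?L" "Y \<in> ?L"
    then obtain x y z x' y' z' where X: "X = x *\<^sub>R A + y *\<^sub>R B + z *\<^sub>R C"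
      and Y: "Y = x' *\<^sub>R A + y' *\<^sub>R B + z' *\<^sub>R C"
      unfolding span_3 by blast
    have mem: "A \<in> ?L" "B \<in> ?L" "C \<in> ?L" by (auto intro: span_base)
    show "lie_bracket X Y \<in> ?L"
      unfolding X Y by (simp add: brs) (intro span_add span_diff span_neg span_scale mem)
  qed
  have full: "?L \<subseteq> derived_series ?L k" for k
  proof (induction k)
    case (Suc k)
    let ?D = "derived_series ?L"
    have mem: "A \<in> ?D k" "B \<in> ?D k" "C \<in> ?D k" using Suc by (auto intro: span_base)
    have "lie_bracket X Y \<in> ?D (Suc k)" if "X \<in> ?D k" "Y \<in> ?D k" for X Y
      using that by (auto intro!: span_base)
    then have "c *\<^sub>R C \<in> ?D (Suc k)" "a *\<^sub>R A \<in> ?D (Suc k)" "b *\<^sub>R B \<in> ?D (Suc k)"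
      using mem br by metis+
    then have "C \<in> ?D (Suc k)" "A \<in> ?D (Suc k)" "B \<in> ?D (Suc k)"
      using nz subspace_scale_cancel[of "?D (Suc k)"] by auto
    then show ?case by (intro span_minimal) (auto simp: subspace_span)
  qed simp
  show ?thesis
    unfolding lie_semisimple_def
  proof (intro conjI allI impI alg)
    fix I assume I: "lie_ideal I ?L \<and> lie_solvable I"
    then have sub: "subspace I" and IL: "I \<subseteq> ?L"
      and ideal: "\<And>X Z. X \<in> ?L \<Longrightarrow> Z \<in> I \<Longrightarrow> lie_bracket X Z \<in> I"
      by (auto simp: lie_ideal_def)
    have mem: "A \<in> ?L" "B \<in> ?L" "C \<in> ?L" by (auto intro: span_base)
    note scale = subspace_scale_cancel[OF sub]
    have AB: "B \<in> I" if "A \<in> I"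
      using ideal[OF mem(3) that] nz(2) unfolding br by (rule scale)
    have BC: "C \<in> I" if "B \<in> I"
      using ideal[OF mem(1) that] nz(3) unfolding br by (rule scale)
    have CA: "A \<in> I" if "C \<in> I"
      using ideal[OF mem(2) that] nz(1) unfolding br by (rule scale)
    show "I = {0}"
    proof (rule ccontr)
      assume "I \<noteq> {0}"
      then obtain Z where Z: "Z \<in> I" "Z \<noteq> 0" using subspace_0[OF sub] by blast
      then obtain x y z where Z_eq: "Z = x *\<^sub>R A + y *\<^sub>R B + z *\<^sub>R C"
        using IL unfolding span_3 by blast
      \<comment> \<open>(\<open>ad A\<close>)^2 kills A and multiplies B and C by -bc, so it
        separates x A from the rest; (\<open>ad B\<close>)^2 then isolates C in the same
        way.\<close>
      have "lie_bracket A (lie_bracket A Z) \<in> I" by (intro ideal mem Z)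
      then have "(- (b * c)) *\<^sub>R (y *\<^sub>R B + z *\<^sub>R C) \<in> I" by (simp add: Z_eq brs algebra_simps)
      from scale[OF this] nz have yz: "y *\<^sub>R B + z *\<^sub>R C \<in> I" by simp
      then have "Z - (y *\<^sub>R B + z *\<^sub>R C) \<in> I" using Z(1) sub subspace_diff by blast
      then have xA: "x *\<^sub>R A \<in> I" by (simp add: Z_eq)
      have "lie_bracket B (lie_bracket B (y *\<^sub>R B + z *\<^sub>R C)) \<in> I" by (intro ideal mem yz)
      then have "(- (a * c)) *\<^sub>R (z *\<^sub>R C) \<in> I" by (simp add: brs algebra_simps)
      from scale[OF this] nz have zC: "z *\<^sub>R C \<in> I" by simp
      have yB: "y *\<^sub>R B \<in> I" using subspace_diff[OF sub yz zC] by simp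
      have "x \<noteq> 0 \<or> y \<noteq> 0 \<or> z \<noteq> 0" using Z by (auto simp: Z_eq)
      then have "A \<in> I \<or> B \<in> I \<or> C \<in> I" using xA yB zC scale by blast
      then have ABC: "A \<in> I" "B \<in> I" "C \<in> I" using AB BC CA by blast+
      then have "?L \<subseteq> I" using sub by (intro span_minimal) auto
      then have "I = ?L" using IL by blast
      moreover obtain k where "derived_series I k = {0}" using I by (auto simp: lie_solvable_def)
      ultimately show False using full[of k] Z(1,2) by blast
    qed
  qed
qed

text \<open>A standard triple H, X, Y is not cyclic, but H, X + Y, X - Y is; \<open>u_3_17\<close>
  is treated in the same way.\<close>

lemma u_3_16_semisimple: "lie_semisimple u_3_16"
proof -
  have eq: "u_3_16 = span {mat3 1 0 0 0 0 0 0 0 (-1), mat3 0 0 1 0 0 0 1 0 0, mat3 0 0 1 0 0 0 (-1) 0 0}" (is "_ = ?S")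
  proof (intro equalityI subsetI)
    fix M assume "M \<in> u_3_16"
    then obtain a b c where M: "M = mat3 c 0 a 0 0 0 b 0 (- c)" by (auto simp: u_3_16_eq)
    have "M = c *\<^sub>R mat3 1 0 0 0 0 0 0 0 (-1) +
          ((a + b) / 2) *\<^sub>R mat3 0 0 1 0 0 0 1 0 0 + ((a - b) / 2) *\<^sub>R mat3 0 0 1 0 0 0 (-1) 0 0"
        by (simp add: M field_simps)
    then show "M \<in> ?S" unfolding span_3 by blast
  next
    fix M assume "M \<in> ?S"
    then show "M \<in> u_3_16" by (auto simp: span_3 u_3_16_eq)
  qed
  show ?thesis
    unfolding eq by (rule cyclic_triple_lie_semisimple[where a = "-2" and b = "-2" and c = 2]) simp_all
qed

lemma u_3_17_semisimple: "lie_semisimple u_3_17"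
proof -
  have eq: "u_3_17 = span {mat3 1 0 0 0 0 0 0 0 (-1), mat3 0 1 0 1 0 1 0 1 0, mat3 0 1 0 (-1) 0 1 0 (-1) 0}" (is "_ = ?S")
  proof (intro equalityI subsetI)
    fix M assume "M \<in> u_3_17"
    then obtain a b c where M: "M = mat3 c a 0 b 0 a 0 b (- c)" by (auto simp: u_3_17_eq)
    have "M = c *\<^sub>R mat3 1 0 0 0 0 0 0 0 (-1) +
          ((a + b) / 2) *\<^sub>R mat3 0 1 0 1 0 1 0 1 0 + ((a - b) / 2) *\<^sub>R mat3 0 1 0 (-1) 0 1 0 (-1) 0"
        by (simp add: M field_simps)
    then show "M \<in> ?S" unfolding span_3 by blast
  next
    fix M assume "M \<in> ?S"
    then show "M \<in> u_3_17" by (auto simp: span_3 u_3_17_eq)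
  qed
  show ?thesis
    unfolding eq by (rule cyclic_triple_lie_semisimple[where a = "-2" and b = "-1" and c = 1]) simp_all
qed

lemma u_3_18_semisimple: "lie_semisimple u_3_18"
  unfolding u_3_18_def
  by (rule cyclic_triple_lie_semisimple[where a = "-1/2" and b = "-1" and c = "-1"])
     (simp_all add: sl3_basis_defs mat_unit_mat3)

text \<open>The trace form is negative definite here, as befits a copy of so(3).\<close>

lemma u_3_18_nilpotent_free: "nilpotent_free u_3_18"
  unfolding nilpotent_free_def
proof (intro ballI impI)
  fix X assume "X \<in> u_3_18" and tr: "trace (X ** X) = 0"
  then obtain a b c where X: "X = mat3 0 (8*a) b (- a) 0 (- c) (- b) (8*c) 0"
    by (auto simp: u_3_18_eq)
  have "trace (X ** X) = - (16 * a\<^sup>2 + 2 * b\<^sup>2 + 16 * c\<^sup>2)"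
    by (simp add: X power2_eq_square)
  then have "16 * a\<^sup>2 + 2 * b\<^sup>2 + 16 * c\<^sup>2 = 0" using tr by linarith
  then have "a\<^sup>2 = 0 \<and> b\<^sup>2 = 0 \<and> c\<^sup>2 = 0"
    using zero_le_power2[of a] zero_le_power2[of b] zero_le_power2[of c] by linarith
  then show "X = 0" by (simp add: X)
qed

lemma not_conjugate_u_3_18:
  assumes "X \<in> u" "X \<noteq> 0" "trace (X ** X) = 0" "det X = 0"
  shows "\<not> SL3_conjugate u u_3_18"
proof
  assume "SL3_conjugate u u_3_18"
  then have "nilpotent_free u"
    using u_3_18_nilpotent_free nilpotent_free_conj SL3_conjugate_sym by blast
  then show False using assms unfolding nilpotent_free_def by blast
qed

text \<open>The distinguishing invariant is a nonzero element of square zero: E13 on one side, none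
  on the other.\<close>

lemma not_conjugate_u_3_16_u_3_17: "\<not> SL3_conjugate u_3_16 u_3_17"
proof
  assume "SL3_conjugate u_3_16 u_3_17"
  then obtain g h where gh: "g ** h = mat 1" "h ** g = mat 1" and eq: "u_3_17 = conjm g h ` u_3_16"
    by (auto simp: SL3_conjugate_iff)
  define N where "N = mat3 0 0 1 0 0 0 0 0 0"
  have N: "N \<in> u_3_16" "N ** N = 0" "N \<noteq> 0" by (auto simp: N_def u_3_16_eq)
  have "conjm g h N ** conjm g h N = conjm g h (N ** N)" by (simp add: conjm_mult[OF gh(2)])
  also have "\<dots> = 0" by (simp add: N conjm_def)
  finally have "conjm g h N ** conjm g h N = 0" .
  moreover have "Y = 0" if "Y \<in> u_3_17" "Y ** Y = 0" for Y
    using that by (auto simp: u_3_17_eq)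
  ultimately have "conjm g h N = 0" using N(1) eq by blast
  then have "N = 0" using conjm_inverse[OF gh(2), of N] by (simp add: conjm_def)
  then show False using N by blast
qed

theorem theorem5p3:
  shows "(\<forall>u \<in> {u_3_16, u_3_17, u_3_18}.
            lie_semisimple u \<and> u \<subseteq> sl3 \<and> u \<noteq> {0} \<and> u \<noteq> sl3)
       \<and> (\<forall>u. lie_semisimple u \<and> u \<subseteq> sl3 \<and> u \<noteq> {0} \<and> u \<noteq> sl3 \<longrightarrow>
            SL3_conjugate u u_3_16 \<or> SL3_conjugate u u_3_17 \<or> SL3_conjugate u u_3_18)
       \<and> \<not> SL3_conjugate u_3_16 u_3_17
       \<and> \<not> SL3_conjugate u_3_16 u_3_18
       \<and> \<not> SL3_conjugate u_3_17 u_3_18"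
proof (intro conjI)
  have sub: "u_3_16 \<subseteq> sl3" "u_3_17 \<subseteq> sl3" "u_3_18 \<subseteq> sl3"
    by (auto simp: u_3_16_eq u_3_17_eq u_3_18_eq)
  have N16: "mat3 0 0 1 0 0 0 0 0 0 \<in> u_3_16" by (auto simp: u_3_16_eq)
  have N17: "mat3 0 1 0 0 0 1 0 0 0 \<in> u_3_17" by (auto simp: u_3_17_eq)
  have R18: "mat3 0 0 1 0 0 0 (-1) 0 0 \<in> u_3_18" by (auto simp: u_3_18_eq)
  have nz: "u_3_16 \<noteq> {0}" "u_3_17 \<noteq> {0}" "u_3_18 \<noteq> {0}"
    using N16 N17 R18 mat3_eq_0_iff by (metis singletonD zero_neq_one)+
  \<comment> \<open>diag(1,-1,0) has a nonzero middle entry, whereas all elements of the three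
    algebras have (2,2) entry 0.\<close>
  have "mat3 1 0 0 0 (-1) 0 0 0 0 \<in> sl3"
    "mat3 1 0 0 0 (-1) 0 0 0 0 \<notin> u_3_16" "mat3 1 0 0 0 (-1) 0 0 0 0 \<notin> u_3_17"
    "mat3 1 0 0 0 (-1) 0 0 0 0 \<notin> u_3_18"
    by (auto simp: u_3_16_eq u_3_17_eq u_3_18_eq)
  then have proper: "u_3_16 \<noteq> sl3" "u_3_17 \<noteq> sl3" "u_3_18 \<noteq> sl3" by blast+
  show "\<forall>u \<in> {u_3_16, u_3_17, u_3_18}. lie_semisimple u \<and> u \<subseteq> sl3 \<and> u \<noteq> {0} \<and> u \<noteq> sl3"
    using sub nz proper u_3_16_semisimple u_3_17_semisimple u_3_18_semisimple by blast
  show "\<forall>u. lie_semisimple u \<and> u \<subseteq> sl3 \<and> u \<noteq> {0} \<and> u \<noteq> sl3 \<longrightarrow>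
      SL3_conjugate u u_3_16 \<or> SL3_conjugate u u_3_17 \<or> SL3_conjugate u u_3_18"
    using semisimple_reducible irreducible_classification by blast
  show "\<not> SL3_conjugate u_3_16 u_3_17" by (rule not_conjugate_u_3_16_u_3_17)
  show "\<not> SL3_conjugate u_3_16 u_3_18" by (rule not_conjugate_u_3_18[OF N16]) simp_all
  show "\<not> SL3_conjugate u_3_17 u_3_18" by (rule not_conjugate_u_3_18[OF N17]) simp_all
qed

end
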